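(* Suppose that in the linear model $y(t)=\sum_{i=1}^m\theta_if_i(t)+\varepsilon(t)$, $t\in\mathcal{I}$, the set $\mathcal{I}\subset\mathbb{R}$ is a finite union of closed bounded intervals (singletons allowed), the functions $f_1,\dots,f_m$ are linearly independent rational functions with finite values on $\mathcal{I}$, and $\omega$ is a nonnegative rational function on $\mathcal{I}$ (with denominator positive on $\mathcal{I}$). Put $f(t)=(f_1(t),\dots,f_m(t))^{\mathrm T}$ and $M(\xi_t)=f(t)f(t)^{\mathrm T}\omega(t)$. Let $\Phi:\mathbb{S}^m_+\to\mathbb{R}$ be a semidefinite representable function that is admissible with respect to the set of Fisher information matrices $\mathcal{M}=\operatorname{conv}\{f(t)f(t)^{\mathrm T}\omega(t)\mid t\in\mathcal{I}\}$, with semidefinite representation $(A_i,B_i,C_i,D_i)_{i=1}^p$ (one witnessing admissibility). Then the support of the $\Phi$-optimal design is a subset of the real zeros of the polynomial $\pi$ obtained by solving the following semidefinite programming problem: $$\begin{aligned} \text{minimize}\quad & y\\ \text{over}\quad & y\in\mathbb{R},\ \pi\in\mathbb{R}^{d+1},\ W_i\in\mathbb{S}^{k_i}_+\ (i=1,\dots,p)\\ \text{subject to}\quad & \sum_{i=1}^p\langle W_i,B_i\rangle=-1,\qquad \sum_{i=1}^p C_i^*(W_i)=0,\\ & \pi=\Pi(y,W_1,\dots,W_p),\\ & \pi\in P_d^{\mathcal{I}}, \end{aligned}$$ where $d$ is the degree of the polynomial $$t\mapsto \operatorname{lcm}\big(\operatorname{den}(\omega),\operatorname{den}(f_1^2),\dots,\operatorname{den}(f_m^2)\big)\Big(y-\sum_{i=1}^p\langle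 W_i,A_i(M(\xi_t))+D_i\rangle\Big),$$ whose coefficient vector is denoted by $\Pi(y,W_1,\dots,W_p)$.
   Context: $\mathbb{S}^m$ is the space of real symmetric $m\times m$ matrices, $\mathbb{S}^m_+$ the cone of positive semidefinite ones, and $A\succcurlyeq B$ means that $A-B$ is positive semidefinite. $\langle\cdot,\cdot\rangle$ is the Frobenius inner product, and $C^*$ is the adjoint of a linear operator $C$. $\operatorname{den}(r)$ is the denominator of the rational function $r$, and $\operatorname{lcm}$ is the least common multiple of polynomials. In the model the errors $\varepsilon(t)$ are uncorrelated and normal with mean $0$ and variance $1/\omega(t)$. A design is a finitely supported probability measure $\xi$ on $\mathcal{I}$; its Fisher information matrix is $M(\xi)=\int_{\mathcal{I}}f(t)f(t)^{\mathrm T}\omega(t)\,d\xi(t)\in\mathbb{S}^m_+$. $\xi_t$ is the unit point mass at $t$. A design $\hat\xi$ is $\Phi$-optimal if it maximizes $\Phi(M(\xi))$ over all designs $\xi$ on $\mathcal{I}$. A function $\Phi:\mathbb{S}^m_+\to\mathbb{R}$ is semidefinite representable if for some $p,k_1,\dots,k_p\ge 1$ and $l\ge 0$ there are linear maps $A_i:\mathbb{S}^m\to\mathbb{S}^{k_i}$, $C_i:\mathbb{R}^l\to\mathbb{S}^{k_i}$ and matrices $B_i,D_i\in\mathbb{S}^{k_i}$ ($i=1,\dots,p$) such that for all $X\in\mathbb{S}^m_+$ and $z\in\mathbb{R}$: $\Phi(X)\ge z$ if and only if there exists $u\in\mathbb{R}^l$ with $$A_i(X)+B_iz+C_i(u)+D_i\succcurlyeq0,\qquad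 i=1,\dots,p.$$ Such data is called a semidefinite representation of $\Phi$. $\Phi$ is admissible with respect to $\mathcal{X}\subseteq\mathbb{S}^m_+$ if it has a semidefinite representation for which there exist $\hat X\in\mathcal{X}$, $z\in\mathbb{R}$, $u\in\mathbb{R}^l$ such that all $p$ left-hand sides $A_i(\hat X)+B_iz+C_i(u)+D_i$ are positive definite simultaneously; such a representation is said to witness admissibility. $P_d^{\mathcal{I}}\subset\mathbb{R}^{d+1}$ is the set of coefficient vectors $(p_0,\dots,p_d)$ of real polynomials $\sum_{i=0}^dp_it^i$ that are nonnegative on $\mathcal{I}$; a coefficient vector $\pi$ is identified with the polynomial it defines.
   Formalization: Two hypotheses are added: the expression defining Π(y,W) is a polynomial for all y and all positive semidefinite W_i (otherwise Π and d are undefined), and the lcm can be scaled to be positive on I (the claim can fail when it changes sign between components of I). *)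

theory Defs
  imports
    "HOL-Probability.Probability_Mass_Function"
    "HOL-Computational_Algebra.Field_as_Ring"
    "HOL-Computational_Algebra.Polynomial_Factorial"
    "HOL-Computational_Algebra.Normalized_Fraction"
    "Jordan_Normal_Form.Matrix"
begin

(* From here on $ and the superscript T refer to Jordan_Normal_Form vectors and matrices. *)
unbundle no vec_syntax

subsection \<open>Symmetric matrices\<close>

definition sym_mats :: "nat \<Rightarrow> real mat set" where
  "sym_mats n = {A \<in> carrier_mat n n. A\<^sup>T = A}"

definition psd_mats :: "nat \<Rightarrow> real mat set" where
  "psd_mats n = {A \<in> sym_mats n. \<forall>v \<in> carrier_vec n. 0 \<le> scalar_prod v (A *\<^sub>v v)}"

definition pd_mats :: "nat \<Rightarrow> real mat set" where
  "pd_mats n = {A \<in> sym_mats n. \<forall>v \<in> carrier_vec n. v \<noteq> 0\<^sub>v n \<longrightarrow> 0 < scalar_prod v (A *\<^sub>v v)}"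

definition frob :: "real mat \<Rightarrow> real mat \<Rightarrow> real" where
  "frob A B = (\<Sum>i<dim_row A. \<Sum>j<dim_col A. A $$ (i, j) * B $$ (i, j))"

(* Type real mat mixes all dimensions and is not a real_vector, so the library constant hull
   does not apply; compare the library fact convex_hull_explicit. *)
definition mat_convex_hull :: "nat \<Rightarrow> real mat set \<Rightarrow> real mat set" where
  "mat_convex_hull n S = {X. \<exists>T c. finite T \<and> T \<subseteq> S \<and> (\<forall>Y\<in>T. 0 \<le> c Y) \<and> sum c T = (1::real) \<and>
     X = mat n n (\<lambda>(i, j). \<Sum>Y\<in>T. c Y * Y $$ (i, j))}"

definition linear_sym :: "nat \<Rightarrow> nat \<Rightarrow> (real mat \<Rightarrow> real mat) \<Rightarrow> bool" where
  "linear_sym m k A \<longleftrightarrow>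
     (\<forall>X \<in> sym_mats m. A X \<in> sym_mats k) \<and>
     (\<forall>X \<in> sym_mats m. \<forall>Y \<in> sym_mats m. A (X + Y) = A X + A Y) \<and>
     (\<forall>X \<in> sym_mats m. \<forall>c. A (c \<cdot>\<^sub>m X) = c \<cdot>\<^sub>m A X)"

definition linear_vec_sym :: "nat \<Rightarrow> nat \<Rightarrow> (real vec \<Rightarrow> real mat) \<Rightarrow> bool" where
  "linear_vec_sym l k C \<longleftrightarrow>
     (\<forall>u \<in> carrier_vec l. C u \<in> sym_mats k) \<and>
     (\<forall>u \<in> carrier_vec l. \<forall>v \<in> carrier_vec l. C (u + v) = C u + C v) \<and>
     (\<forall>u \<in> carrier_vec l. \<forall>c. C (c \<cdot>\<^sub>v u) = c \<cdot>\<^sub>m C u)"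

(* The adjoint of C, a linear map from real l-vectors to symmetric matrices. *)
definition adjoint_vec :: "nat \<Rightarrow> (real vec \<Rightarrow> real mat) \<Rightarrow> real mat \<Rightarrow> real vec" where
  "adjoint_vec l C W =
     (THE v. v \<in> carrier_vec l \<and> (\<forall>u \<in> carrier_vec l. frob (C u) W = scalar_prod u v))"

subsection \<open>Semidefinite representations\<close>

definition lmi ::
  "(real mat \<Rightarrow> real mat) \<Rightarrow> real mat \<Rightarrow> (real vec \<Rightarrow> real mat) \<Rightarrow> real mat \<Rightarrow>
   real mat \<Rightarrow> real \<Rightarrow> real vec \<Rightarrow> real mat" where
  "lmi A B C D X z u = A X + z \<cdot>\<^sub>m B + C u + D"

(* Blocks are numbered 0, ..., p - 1. *)
definition sd_representation ::
  "nat \<Rightarrow> (real mat \<Rightarrow> real) \<Rightarrow> nat \<Rightarrow> (nat \<Rightarrow> nat) \<Rightarrow> nat \<Rightarrow>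
   (nat \<Rightarrow> real mat \<Rightarrow> real mat) \<Rightarrow> (nat \<Rightarrow> real mat) \<Rightarrow>
   (nat \<Rightarrow> real vec \<Rightarrow> real mat) \<Rightarrow> (nat \<Rightarrow> real mat) \<Rightarrow> bool" where
  "sd_representation m \<Phi> p k l A B C D \<longleftrightarrow>
     1 \<le> p \<and>
     (\<forall>i<p. 1 \<le> k i \<and> linear_sym m (k i) (A i) \<and> B i \<in> sym_mats (k i) \<and>
            linear_vec_sym l (k i) (C i) \<and> D i \<in> sym_mats (k i)) \<and>
     (\<forall>X \<in> psd_mats m. \<forall>z. z \<le> \<Phi> X \<longleftrightarrow>
        (\<exists>u \<in> carrier_vec l. \<forall>i<p. lmi (A i) (B i) (C i) (D i) X z u \<in> psd_mats (k i)))"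

definition witnesses_admissibility ::
  "nat \<Rightarrow> real mat set \<Rightarrow> (real mat \<Rightarrow> real) \<Rightarrow> nat \<Rightarrow> (nat \<Rightarrow> nat) \<Rightarrow> nat \<Rightarrow>
   (nat \<Rightarrow> real mat \<Rightarrow> real mat) \<Rightarrow> (nat \<Rightarrow> real mat) \<Rightarrow>
   (nat \<Rightarrow> real vec \<Rightarrow> real mat) \<Rightarrow> (nat \<Rightarrow> real mat) \<Rightarrow> bool" where
  "witnesses_admissibility m \<X> \<Phi> p k l A B C D \<longleftrightarrow>
     sd_representation m \<Phi> p k l A B C D \<and>
     (\<exists>X \<in> \<X>. \<exists>z. \<exists>u \<in> carrier_vec l.
        \<forall>i<p. lmi (A i) (B i) (C i) (D i) X z u \<in> pd_mats (k i))"

subsection \<open>Rational functions\<close>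

definition num :: "real poly fract \<Rightarrow> real poly" where
  "num r = fst (quot_of_fract r)"

(* The monic denominator in lowest terms. *)
definition den :: "real poly fract \<Rightarrow> real poly" where
  "den r = snd (quot_of_fract r)"

(* Meaningful wherever the denominator of r does not vanish. *)
definition rat_eval :: "real poly fract \<Rightarrow> real \<Rightarrow> real" where
  "rat_eval r t = poly (num r) t / poly (den r) t"

definition rat_lin_indep :: "nat \<Rightarrow> (nat \<Rightarrow> real poly fract) \<Rightarrow> bool" where
  "rat_lin_indep m f \<longleftrightarrow>
     (\<forall>c :: nat \<Rightarrow> real. (\<Sum>i<m. to_fract [:c i:] * f i) = 0 \<longrightarrow> (\<forall>i<m. c i = 0))"

definition finite_interval_union :: "real set \<Rightarrow> bool" where
  "finite_interval_union I \<longleftrightarrow>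
     (\<exists>E. finite E \<and> (\<forall>(a, b) \<in> E. a \<le> b) \<and> I = (\<Union>(a, b) \<in> E. {a..b}))"

subsection \<open>Designs\<close>

definition design :: "real set \<Rightarrow> real pmf \<Rightarrow> bool" where
  "design I \<xi> \<longleftrightarrow> finite (set_pmf \<xi>) \<and> set_pmf \<xi> \<subseteq> I"

(* The regression functions are f 0, ..., f (m - 1). *)
definition fisher :: "nat \<Rightarrow> (nat \<Rightarrow> real poly fract) \<Rightarrow> real poly fract \<Rightarrow> real pmf \<Rightarrow> real mat" where
  "fisher m f \<omega> \<xi> = mat m m (\<lambda>(i, j).
     measure_pmf.expectation \<xi> (\<lambda>t. rat_eval (f i) t * rat_eval (f j) t * rat_eval \<omega> t))"

definition fisher_point :: "nat \<Rightarrow> (nat \<Rightarrow> real poly fract) \<Rightarrow> real poly fract \<Rightarrow> real \<Rightarrow> real mat" where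
  "fisher_point m f \<omega> t = mat m m (\<lambda>(i, j). rat_eval (f i) t * rat_eval (f j) t * rat_eval \<omega> t)"

lemma fisher_return_pmf: "fisher m f \<omega> (return_pmf t) = fisher_point m f \<omega> t"
  by (simp add: fisher_def fisher_point_def)

definition optimal_design ::
  "nat \<Rightarrow> (nat \<Rightarrow> real poly fract) \<Rightarrow> real poly fract \<Rightarrow> real set \<Rightarrow> (real mat \<Rightarrow> real) \<Rightarrow>
   real pmf \<Rightarrow> bool" where
  "optimal_design m f \<omega> I \<Phi> = is_arg_max (\<lambda>\<xi>. \<Phi> (fisher m f \<omega> \<xi>)) (design I)"

subsection \<open>The semidefinite program\<close>

(* The monic representative.  Since an lcm is determined only up to a nonzero constant, statements
   use a multiplier L with normalize L = den_lcm m f \<omega> that is positive on the design region. *)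
definition den_lcm :: "nat \<Rightarrow> (nat \<Rightarrow> real poly fract) \<Rightarrow> real poly fract \<Rightarrow> real poly" where
  "den_lcm m f \<omega> = lcm (den \<omega>) (Lcm ((\<lambda>i. den (f i ^ 2)) ` {..<m}))"

(* The polynomial q equals, as a rational function, the multiplier L times
   y - (\<Sum>i<p. <W i, A i (M(xi_t)) + D i>).  When L is an lcm of the denominators,
   all values of f and \<omega> are defined at the points that are not roots of L,
   and these points determine q. *)
definition is_dual_poly ::
  "nat \<Rightarrow> (nat \<Rightarrow> real poly fract) \<Rightarrow> real poly fract \<Rightarrow> real poly \<Rightarrow> nat \<Rightarrow>
   (nat \<Rightarrow> real mat \<Rightarrow> real mat) \<Rightarrow> (nat \<Rightarrow> real mat) \<Rightarrow>
   real \<Rightarrow> (nat \<Rightarrow> real mat) \<Rightarrow> real poly \<Rightarrow> bool" where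
  "is_dual_poly m f \<omega> L p A D y W q \<longleftrightarrow>
     (\<forall>t. poly L t \<noteq> 0 \<longrightarrow>
        poly q t = poly L t * (y - (\<Sum>i<p. frob (W i) (A i (fisher_point m f \<omega> t) + D i))))"

(* Clearing by the lcm gives a polynomial only if the denominators of f and \<omega> fit together:
   for f 0 = \<omega> = 1 / (1 + t^2) and A, D not cancelling this entry it does not.
   Existence of q is therefore a separate hypothesis wherever dual_poly is used. *)
definition dual_poly ::
  "nat \<Rightarrow> (nat \<Rightarrow> real poly fract) \<Rightarrow> real poly fract \<Rightarrow> real poly \<Rightarrow> nat \<Rightarrow>
   (nat \<Rightarrow> real mat \<Rightarrow> real mat) \<Rightarrow> (nat \<Rightarrow> real mat) \<Rightarrow>
   real \<Rightarrow> (nat \<Rightarrow> real mat) \<Rightarrow> real poly" where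
  "dual_poly m f \<omega> L p A D y W = (THE q. is_dual_poly m f \<omega> L p A D y W q)"

(* The degree of dual_poly drops for special (y, W); d is the degree for generic (y, W). *)
definition dual_degree ::
  "nat \<Rightarrow> (nat \<Rightarrow> real poly fract) \<Rightarrow> real poly fract \<Rightarrow> real poly \<Rightarrow> nat \<Rightarrow> (nat \<Rightarrow> nat) \<Rightarrow>
   (nat \<Rightarrow> real mat \<Rightarrow> real mat) \<Rightarrow> (nat \<Rightarrow> real mat) \<Rightarrow> nat" where
  "dual_degree m f \<omega> L p k A D =
     Max {degree (dual_poly m f \<omega> L p A D y W) | y W. \<forall>i<p. W i \<in> psd_mats (k i)}"

(* Coefficient vectors of length d + 1 are identified with polynomials of degree at most d. *)
definition nonneg_polys :: "nat \<Rightarrow> real set \<Rightarrow> real poly set" where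
  "nonneg_polys d I = {q. degree q \<le> d \<and> (\<forall>t \<in> I. 0 \<le> poly q t)}"

definition sdp_feasible ::
  "nat \<Rightarrow> (nat \<Rightarrow> real poly fract) \<Rightarrow> real poly fract \<Rightarrow> real set \<Rightarrow> real poly \<Rightarrow>
   nat \<Rightarrow> (nat \<Rightarrow> nat) \<Rightarrow> nat \<Rightarrow> (nat \<Rightarrow> real mat \<Rightarrow> real mat) \<Rightarrow> (nat \<Rightarrow> real mat) \<Rightarrow>
   (nat \<Rightarrow> real vec \<Rightarrow> real mat) \<Rightarrow> (nat \<Rightarrow> real mat) \<Rightarrow>
   real \<times> real poly \<times> (nat \<Rightarrow> real mat) \<Rightarrow> bool" where
  "sdp_feasible m f \<omega> I L p k l A B C D = (\<lambda>(y, \<pi>, W).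
     (\<forall>i<p. W i \<in> psd_mats (k i)) \<and>
     (\<Sum>i<p. frob (W i) (B i)) = -1 \<and>
     (\<forall>j<l. (\<Sum>i<p. adjoint_vec l (C i) (W i) $ j) = 0) \<and>
     \<pi> = dual_poly m f \<omega> L p A D y W \<and>
     \<pi> \<in> nonneg_polys (dual_degree m f \<omega> L p k A D) I)"

definition sdp_solution ::
  "nat \<Rightarrow> (nat \<Rightarrow> real poly fract) \<Rightarrow> real poly fract \<Rightarrow> real set \<Rightarrow> real poly \<Rightarrow>
   nat \<Rightarrow> (nat \<Rightarrow> nat) \<Rightarrow> nat \<Rightarrow> (nat \<Rightarrow> real mat \<Rightarrow> real mat) \<Rightarrow> (nat \<Rightarrow> real mat) \<Rightarrow>
   (nat \<Rightarrow> real vec \<Rightarrow> real mat) \<Rightarrow> (nat \<Rightarrow> real mat) \<Rightarrow>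
   real \<times> real poly \<times> (nat \<Rightarrow> real mat) \<Rightarrow> bool" where
  "sdp_solution m f \<omega> I L p k l A B C D =
     is_arg_min (\<lambda>(y, \<pi>, W). y) (sdp_feasible m f \<omega> I L p k l A B C D)"

end

theory Submission
  imports Defs
begin

text \<open>
  Weak duality: for a feasible \<open>(y, \<pi>, W)\<close> and any design, integrating \<open>\<pi> / L \<ge> 0\<close> over the
  design and pairing \<open>W\<close> with the linear matrix inequality at its information matrix gives
  \<open>\<Phi> (M \<xi>) \<le> y\<close>. If \<open>y\<close> equals the optimal value, the integral of \<open>\<pi> / L\<close> over the optimal
  design vanishes, so \<open>\<pi>\<close> is zero on the support. That the minimum is at most the optimal value
  is strong duality: homogenize the linear matrix inequality at levels above the optimal value to
  a convex cone that contains no uniformly positive definite element, and separate it from the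
  positive definite cone. The identity matrix is an order unit, so a finite-dimensional
  Hahn--Banach extension does the separation and no topology is needed. Slater's condition makes
  the multiplier of \<open>B\<close> nonzero.
\<close>

text \<open>The parameter \<open>u\<close> of a representation runs over a whole space, so the
  matrices that the inequality produces need not form a closed cone; still the proof exhibits a dual
  point at exactly the optimal value. What it uses is that, as quadratic forms, every family of
  blocks lies below a multiple of the identity. The infimum of such multiples, relative to the cone
  K = (semidefinite blocks) - (homogenized values of the inequality), is a finite sublinear
  functional, and any linear functional below it is a multiplier, with value at least 1 at the
  identity. If the multiplier of \<open>B\<close> vanished, the pairing with a strictly feasible
  point would be at most 0, whereas a nonzero semidefinite matrix pairs positively with a positive
  definite one. That last fact comes from eliminating one index at a time by Schur complements. The
  separation works on arrays of entries over a finite index set, since \<open>real mat\<close> mixes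
  all dimensions and is not a vector space.\<close>

unbundle no inner_syntax

subsection \<open>Separation\<close>

text \<open>Subspaces are encoded by supports, and one coordinate is added at a time. Domination at
  x - e and x + e asks the new weight to lie above every \<open>lo x\<close> and below every
  \<open>hi x\<close>; subadditivity of \<open>p\<close> puts the first family below the
  second.\<close>

lemma coordinate_Hahn_Banach:
  fixes p :: "('i \<Rightarrow> real) \<Rightarrow> real"
  assumes J: "finite J"
    and sub: "\<And>x y. p (\<lambda>j. x j + y j) \<le> p x + p y"
    and hom: "\<And>c x. 0 < c \<Longrightarrow> p (\<lambda>j. c * x j) = c * p x"
  shows "\<exists>w. \<forall>x. (\<forall>j. j \<notin> J \<longrightarrow> x j = 0) \<longrightarrow> (\<Sum>j\<in>J. w j * x j) \<le> p x"
  using J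
proof (induction J)
  case empty
  have "0 \<le> p (\<lambda>j. 0)"
    using sub[of "\<lambda>j. 0" "\<lambda>j. 0"] by simp
  moreover have "p x = p (\<lambda>j. 0)" if "\<forall>j. x j = 0" for x :: "'i \<Rightarrow> real"
    using that by (intro arg_cong[of _ _ p]) auto
  ultimately show ?case by (metis empty_iff sum.empty)
next
  case (insert i J)
  then obtain w where w: "\<And>x. (\<And>j. j \<notin> J \<Longrightarrow> x j = 0) \<Longrightarrow> (\<Sum>j\<in>J. w j * x j) \<le> p x"
    by blast
  define V where "V = {x :: 'i \<Rightarrow> real. \<forall>j. j \<notin> J \<longrightarrow> x j = 0}"
  define e where "e = (\<lambda>j. if j = i then 1 else 0 :: real)"
  define lo where "lo x = (\<Sum>j\<in>J. w j * x j) - p (\<lambda>j. x j - e j)" for x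
  define hi where "hi x = p (\<lambda>j. x j + e j) - (\<Sum>j\<in>J. w j * x j)" for x
  have lo_hi: "lo x \<le> hi x'" if "x \<in> V" "x' \<in> V" for x x'
  proof -
    have "(\<Sum>j\<in>J. w j * (x j + x' j)) \<le> p (\<lambda>j. x j + x' j)"
      using that by (intro w) (auto simp: V_def)
    moreover have "p (\<lambda>j. x j + x' j) \<le> p (\<lambda>j. x j - e j) + p (\<lambda>j. x' j + e j)"
      using sub[of "\<lambda>j. x j - e j" "\<lambda>j. x' j + e j"] by (simp add: algebra_simps)
    ultimately show ?thesis
      by (simp add: lo_def hi_def sum.distrib algebra_simps)
  qed
  have V0: "(\<lambda>j. 0) \<in> V" by (simp add: V_def)
  define \<alpha> where "\<alpha> = Sup (lo ` V)"
  have bdd: "bdd_above (lo ` V)"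
    using lo_hi V0 by (auto intro!: bdd_aboveI)
  have lo_le: "lo x \<le> \<alpha>" if "x \<in> V" for x
    unfolding \<alpha>_def using that bdd by (auto intro!: cSup_upper)
  have le_hi: "\<alpha> \<le> hi x" if "x \<in> V" for x
    unfolding \<alpha>_def using that V0 lo_hi by (intro cSup_least) auto
  define w' where "w' = w(i := \<alpha>)"
  show ?case
  proof (intro exI[of _ w'] allI impI)
    fix x :: "'i \<Rightarrow> real"
    assume x: "\<forall>j. j \<notin> insert i J \<longrightarrow> x j = 0"
    define z where "z = x(i := 0)"
    have x_eq: "x j = z j + x i * e j" for j
      by (simp add: z_def e_def)
    have zV: "z \<in> V" using x by (auto simp: V_def z_def)
    have scV: "(\<lambda>j. c * z j) \<in> V" for c using zV by (simp add: V_def)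
    have "(\<Sum>j\<in>insert i J. w' j * x j) = \<alpha> * x i + (\<Sum>j\<in>J. w' j * x j)"
      using insert.hyps by (simp add: w'_def)
    also have "(\<Sum>j\<in>J. w' j * x j) = (\<Sum>j\<in>J. w j * z j)"
      using insert.hyps by (intro sum.cong) (auto simp: w'_def z_def)
    finally have eq: "(\<Sum>j\<in>insert i J. w' j * x j) = \<alpha> * x i + (\<Sum>j\<in>J. w j * z j)" .
    \<comment> \<open>The sign of the coefficient of \<open>e\<close> decides which bound on the new
      weight applies: homogeneity rescales it to 1 for \<open>le_hi\<close> or to -1 for
      \<open>lo_le\<close>.\<close>
    consider "x i = 0" | "0 < x i" | "x i < 0" by linarith
    then show "(\<Sum>j\<in>insert i J. w' j * x j) \<le> p x"
    proof cases
      case 1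
      then have "z = x" by (auto simp: z_def)
      with eq 1 w[of z] zV show ?thesis by (auto simp: V_def)
    next
      case 2
      have px: "p x = x i * p (\<lambda>j. (1 / x i) * z j + e j)"
      proof -
        have "x = (\<lambda>j. x i * ((1 / x i) * z j + e j))"
        proof
          show "x j = x i * ((1 / x i) * z j + e j)" for j
            using 2 x_eq[of j] by (simp add: distrib_left)
        qed
        then show ?thesis using hom[OF 2, of "\<lambda>j. (1 / x i) * z j + e j"] by simp
      qed
      have "\<alpha> \<le> hi (\<lambda>j. (1 / x i) * z j)" by (rule le_hi[OF scV])
      then have "x i * \<alpha> \<le> x i * hi (\<lambda>j. (1 / x i) * z j)"
        using 2 by simp
      also have "\<dots> = p x - (\<Sum>j\<in>J. w j * z j)"
        using 2 unfolding hi_def px by (simp add: right_diff_distrib sum_distrib_left)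
      finally show ?thesis by (simp add: eq mult.commute)
    next
      case 3
      have px: "p x = (- x i) * p (\<lambda>j. (1 / (- x i)) * z j - e j)"
      proof -
        have "x = (\<lambda>j. (- x i) * ((1 / (- x i)) * z j - e j))"
        proof
          show "x j = (- x i) * ((1 / (- x i)) * z j - e j)" for j
            using 3 x_eq[of j] by (simp add: right_diff_distrib)
        qed
        then show ?thesis
          using hom[of "- x i" "\<lambda>j. (1 / (- x i)) * z j - e j"] 3 by simp
      qed
      have "lo (\<lambda>j. (1 / (- x i)) * z j) \<le> \<alpha>" by (rule lo_le[OF scV])
      then have "(- x i) * lo (\<lambda>j. (1 / (- x i)) * z j) \<le> (- x i) * \<alpha>"
        using 3 by (intro mult_left_mono) auto
      moreover have "(- x i) * lo (\<lambda>j. (1 / (- x i)) * z j) = (\<Sum>j\<in>J. w j * z j) - p x"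
        using 3 unfolding lo_def px by (simp add: right_diff_distrib sum_distrib_left)
      ultimately show ?thesis by (simp add: eq mult.commute)
    qed
  qed
qed

text \<open>\<open>p\<close> is the gauge of the order unit \<open>e\<close>. It is finite because
  \<open>unit\<close> makes \<open>S x\<close> nonempty and \<open>proper\<close> bounds it below,
  and sublinear because \<open>K\<close> is a convex cone. For a functional below \<open>p\<close>,
  p (- x) at most 0 on \<open>K\<close> yields nonnegativity there, and p (- e) at most -1 keeps it
  from being zero.\<close>

lemma order_unit_functional:
  fixes K :: "('i \<Rightarrow> real) set"
  assumes J: "finite J"
    and zero: "(\<lambda>j. 0) \<in> K"
    and add: "\<And>x y. x \<in> K \<Longrightarrow> y \<in> K \<Longrightarrow> (\<lambda>j. x j + y j) \<in> K"
    and scale: "\<And>c x. 0 < c \<Longrightarrow> x \<in> K \<Longrightarrow> (\<lambda>j. c * x j) \<in> K"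
    and unit: "\<And>x. \<exists>r. (\<lambda>j. r * e j - x j) \<in> K"
    and proper: "(\<lambda>j. - e j) \<notin> K"
    and supp: "\<And>j. j \<notin> J \<Longrightarrow> e j = 0"
  shows "\<exists>w. (\<forall>x\<in>K. (\<forall>j. j \<notin> J \<longrightarrow> x j = 0) \<longrightarrow> 0 \<le> (\<Sum>j\<in>J. w j * x j)) \<and>
             1 \<le> (\<Sum>j\<in>J. w j * e j)"
proof -
  define S where "S x = {r. (\<lambda>j. r * e j - x j) \<in> K}" for x
  define p where "p x = Inf (S x)" for x
  have ne: "S x \<noteq> {}" for x using unit by (auto simp: S_def)
  have sumS: "r + r' \<in> S (\<lambda>j. x j + x' j)" if "r \<in> S x" "r' \<in> S x'" for r r' x x'
    using add[of "\<lambda>j. r * e j - x j" "\<lambda>j. r' * e j - x' j"] that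
    by (simp add: S_def algebra_simps)
  have scS: "c * r \<in> S (\<lambda>j. c * x j)" if "0 < c" "r \<in> S x" for c r x
    using scale[of c "\<lambda>j. r * e j - x j"] that
    by (simp add: S_def algebra_simps)
  have nonneg: "0 \<le> r" if "r \<in> S (\<lambda>j. 0)" for r
  proof (rule ccontr)
    assume "\<not> 0 \<le> r"
    then have "(1 / - r) * r \<in> S (\<lambda>j. (1 / - r) * 0)"
      using that by (intro scS) auto
    with \<open>\<not> 0 \<le> r\<close> proper show False by (simp add: S_def)
  qed
  have bdd: "bdd_below (S x)" for x
  proof -
    \<comment> \<open>An upper bound for - x gives a lower bound for \<open>S x\<close>: the sum of
      the two lies in \<open>S\<close> at 0, whose members are nonnegative.\<close>
    obtain R where R: "R \<in> S (\<lambda>j. - x j)" using ne by blast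
    have "- R \<le> r" if "r \<in> S x" for r
      using nonneg[of "r + R"] sumS[OF that R] by simp
    then show ?thesis by (rule bdd_belowI)
  qed
  have sub: "p (\<lambda>j. x j + y j) \<le> p x + p y" for x y
  proof -
    have "p (\<lambda>j. x j + y j) - r \<le> p x" if r: "r \<in> S y" for r
      unfolding p_def[of x]
    proof (rule cInf_greatest[OF ne])
      fix r' assume "r' \<in> S x"
      from cInf_lower[OF sumS[OF this r] bdd]
      show "p (\<lambda>j. x j + y j) - r \<le> r'" by (simp add: p_def)
    qed
    then have "p (\<lambda>j. x j + y j) - p x \<le> p y"
      unfolding p_def[of y] by (intro cInf_greatest[OF ne]) (simp add: algebra_simps)
    then show ?thesis by simp
  qed
  have hom_le: "p (\<lambda>j. c * x j) \<le> c * p x" if c: "0 < c" for c x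
  proof -
    have "p (\<lambda>j. c * x j) / c \<le> p x"
      unfolding p_def[of x]
    proof (rule cInf_greatest[OF ne])
      fix r assume "r \<in> S x"
      from cInf_lower[OF scS[OF c this] bdd]
      show "p (\<lambda>j. c * x j) / c \<le> r" using c by (simp add: p_def field_simps)
    qed
    then show ?thesis using c by (simp add: field_simps)
  qed
  have hom: "p (\<lambda>j. c * x j) = c * p x" if c: "0 < c" for c x
  proof (rule antisym[OF hom_le[OF c]])
    have "p (\<lambda>j. (1 / c) * (c * x j)) \<le> (1 / c) * p (\<lambda>j. c * x j)"
      using c by (intro hom_le) auto
    moreover have "(\<lambda>j. (1 / c) * (c * x j)) = x" using c by auto
    ultimately show "c * p x \<le> p (\<lambda>j. c * x j)" using c by (simp add: field_simps)
  qed
  obtain w where w: "\<And>x. (\<And>j. j \<notin> J \<Longrightarrow> x j = 0) \<Longrightarrow> (\<Sum>j\<in>J. w j * x j) \<le> p x"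
    using coordinate_Hahn_Banach[of J p, OF J sub hom] by blast
  show ?thesis
  proof (intro exI[of _ w] conjI ballI impI)
    fix x assume x: "x \<in> K" "\<forall>j. j \<notin> J \<longrightarrow> x j = 0"
    have "p (\<lambda>j. - x j) \<le> 0"
      unfolding p_def using x by (intro cInf_lower bdd) (simp add: S_def)
    with w[of "\<lambda>j. - x j"] x show "0 \<le> (\<Sum>j\<in>J. w j * x j)"
      by (simp add: sum_negf)
  next
    have "p (\<lambda>j. - e j) \<le> -1"
      unfolding p_def using zero by (intro cInf_lower bdd) (simp add: S_def)
    with w[of "\<lambda>j. - e j"] supp show "1 \<le> (\<Sum>j\<in>J. w j * e j)"
      by (simp add: sum_negf)
  qed
qed

section \<open>Pairings of positive semidefinite forms, by elimination of indices\<close>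

lemma psd_zero_diagonal:
  fixes W :: "'a \<Rightarrow> 'a \<Rightarrow> real"
  assumes J: "finite J" and ab: "a \<in> J" "b \<in> J" and sym: "W b a = W a b"
    and psd: "\<And>g. 0 \<le> (\<Sum>a\<in>J. \<Sum>b\<in>J. W a b * g a * g b)"
    and diag: "W a a = 0"
  shows "W a b = 0"
proof (cases "a = b")
  case False
  \<comment> \<open>With \<open>s\<close> at \<open>a\<close> and 1 at \<open>b\<close> the form is
    affine in \<open>s\<close>, because its quadratic coefficient is the vanishing diagonal entry. A
    nonzero slope would let it reach -1, which is how \<open>s\<close> is chosen below.\<close>
  have two: "0 \<le> 2 * s * W a b + W b b" for s
  proof -
    define g where "g = (\<lambda>c. if c = a then s else if c = b then 1 else 0)"
    have "(\<Sum>c\<in>J. \<Sum>d\<in>J. W c d * g c * g d) =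
        (\<Sum>c\<in>{a,b}. \<Sum>d\<in>{a,b}. W c d * g c * g d)"
      using J ab by (intro sum.mono_neutral_cong_right) (auto simp: g_def intro!: sum.mono_neutral_right)
    also have "\<dots> = 2 * s * W a b + W b b"
      using False sym diag by (simp add: g_def)
    finally show ?thesis using psd[of g] by simp
  qed
  show ?thesis
  proof (rule ccontr)
    assume "W a b \<noteq> 0"
    with two[of "- (W b b + 1) / (2 * W a b)"] show False by simp
  qed
qed (use diag in simp)

text \<open>The value \<open>- s / W j j\<close> at \<open>j\<close> minimizes the form when the
  other coordinates are fixed and \<open>W j j\<close> is positive; what remains is the form of the
  Schur complement. For \<open>W j j = 0\<close> division by zero returns 0, and the argument
  reduces to restricting the form to \<open>J\<close>.\<close>

lemma psd_Schur_complement: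
  fixes W :: "'a \<Rightarrow> 'a \<Rightarrow> real"
  assumes J: "finite J" "j \<notin> J"
    and sym: "\<And>a b. a \<in> insert j J \<Longrightarrow> b \<in> insert j J \<Longrightarrow> W a b = W b a"
    and psd: "\<And>g. 0 \<le> (\<Sum>a\<in>insert j J. \<Sum>b\<in>insert j J. W a b * g a * g b)"
  shows "0 \<le> (\<Sum>a\<in>J. \<Sum>b\<in>J. (W a b - W a j * W j b / W j j) * g a * g b)"
proof -
  define s where "s = (\<Sum>b\<in>J. W j b * g b)"
  define h where "h = g(j := - s / W j j)"
  have hg: "h a = g a" if "a \<in> J" for a using that J by (auto simp: h_def)
  have s1: "(\<Sum>b\<in>J. W j b * h b) = s" 
    unfolding s_def by (intro sum.cong) (auto simp: hg)
  have s2: "(\<Sum>a\<in>J. W a j * h a) = s" 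
    unfolding s_def using sym by (intro sum.cong) (auto simp: hg)
  have s3: "(\<Sum>a\<in>J. \<Sum>b\<in>J. W a b * h a * h b) = (\<Sum>a\<in>J. \<Sum>b\<in>J. W a b * g a * g b)"
    by (intro sum.cong) (auto simp: hg)
  have "(\<Sum>a\<in>insert j J. \<Sum>b\<in>insert j J. W a b * h a * h b) =
      W j j * h j * h j + h j * (\<Sum>b\<in>J. W j b * h b) + h j * (\<Sum>a\<in>J. W a j * h a) +
      (\<Sum>a\<in>J. \<Sum>b\<in>J. W a b * h a * h b)"
    using J by (simp add: sum.distrib sum_distrib_left sum_distrib_right algebra_simps)
  also have "\<dots> = (\<Sum>a\<in>J. \<Sum>b\<in>J. W a b * g a * g b) - s * s / W j j"
    unfolding s1 s2 s3 by (cases "W j j = 0") (simp_all add: h_def field_simps)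
  also have "s * s / W j j = (\<Sum>a\<in>J. \<Sum>b\<in>J. (W a j * W j b / W j j) * g a * g b)"
  proof -
    have "s = (\<Sum>a\<in>J. W a j * g a)" unfolding s_def using sym by (intro sum.cong) auto
    then have "s * s / W j j = (\<Sum>a\<in>J. W a j * g a) * (\<Sum>b\<in>J. W j b * g b) / W j j"
      by (simp add: s_def)
    then show ?thesis by (simp add: sum_product sum_divide_distrib algebra_simps)
  qed
  finally show ?thesis
    using psd[of h] by (simp add: sum_subtractf left_diff_distrib)
qed

lemma quadratic_form_unit:
  fixes W :: "'a \<Rightarrow> 'a \<Rightarrow> real"
  assumes J: "finite J" "j \<in> J"
  shows "(\<Sum>a\<in>J. \<Sum>b\<in>J. W a b * of_bool (a = j) * of_bool (b = j)) = W j j"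
proof -
  have "(\<Sum>a\<in>J. \<Sum>b\<in>J. W a b * of_bool (a = j) * of_bool (b = j)) =
      (\<Sum>a\<in>J. \<Sum>b\<in>J. if b = j then (if a = j then W a b else 0) else 0)"
    by (intro sum.cong) auto
  then show ?thesis using J by simp
qed

text \<open>\<open>W\<close> is a rank-one part built from column \<open>j\<close> plus its Schur
  complement, which lives on \<open>J\<close>. The rank-one part pairs with \<open>G\<close> to a
  value of the form of \<open>G\<close> divided by \<open>W j j\<close>, and the complement is
  covered by induction. If the pairing is zero and \<open>G\<close> is definite, both nonnegative
  parts vanish; then \<open>W j j = 0\<close>, so row and column \<open>j\<close> vanish and the
  complement is \<open>W\<close> itself.\<close>

lemma
  fixes W G :: "'a \<Rightarrow> 'a \<Rightarrow> real"
  assumes "finite J"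
    and "\<And>a b. a \<in> J \<Longrightarrow> b \<in> J \<Longrightarrow> W a b = W b a"
    and "\<And>g. 0 \<le> (\<Sum>a\<in>J. \<Sum>b\<in>J. W a b * g a * g b)"
    and "\<And>g. 0 \<le> (\<Sum>a\<in>J. \<Sum>b\<in>J. G a b * g a * g b)"
  shows psd_pairing_nonneg: "0 \<le> (\<Sum>a\<in>J. \<Sum>b\<in>J. W a b * G a b)"
    and psd_pairing_zero:
      "(\<And>g. (\<exists>a\<in>J. g a \<noteq> 0) \<Longrightarrow> 0 < (\<Sum>a\<in>J. \<Sum>b\<in>J. G a b * g a * g b)) \<Longrightarrow>
       (\<Sum>a\<in>J. \<Sum>b\<in>J. W a b * G a b) = 0 \<Longrightarrow> \<forall>a\<in>J. \<forall>b\<in>J. W a b = 0"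
proof -
  \<comment> \<open>Both claims share one induction: splitting a zero pairing into two zero parts
    uses nonnegativity of the smaller pairing.\<close>
  have "0 \<le> (\<Sum>a\<in>J. \<Sum>b\<in>J. W a b * G a b) \<and>
      ((\<forall>g. (\<exists>a\<in>J. g a \<noteq> 0) \<longrightarrow> 0 < (\<Sum>a\<in>J. \<Sum>b\<in>J. G a b * g a * g b)) \<longrightarrow>
       (\<Sum>a\<in>J. \<Sum>b\<in>J. W a b * G a b) = 0 \<longrightarrow> (\<forall>a\<in>J. \<forall>b\<in>J. W a b = 0))"
    using assms
  proof (induction J arbitrary: W)
    case empty
    then show ?case by simp
  next
    case (insert j J)
    \<comment> \<open>If \<open>W j j = 0\<close>, row \<open>j\<close> vanishes and the quotient is \<open>0\<close> as well.\<close>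
    define W' where "W' a b = W a b - W a j * W j b / W j j" for a b
    have restr: "(\<Sum>a\<in>insert j J. \<Sum>b\<in>insert j J. G a b * (g(j := 0)) a * (g(j := 0)) b) =
        (\<Sum>a\<in>J. \<Sum>b\<in>J. G a b * g a * g b)" for g
      using insert.hyps by (auto intro!: sum.cong)
    have G_J: "0 \<le> (\<Sum>a\<in>J. \<Sum>b\<in>J. G a b * g a * g b)" for g
      using insert.prems(3)[of "g(j := 0)"] restr[of g] by simp
    have row: "W j j = 0 \<Longrightarrow> b \<in> insert j J \<Longrightarrow> W j b = 0" for b
      using psd_zero_diagonal[of "insert j J" j b W] insert.hyps insert.prems(1,2) by blast
    have W'0: "W' j b = 0" "W' b j = 0" if "b \<in> insert j J" for b
      using row[OF _ that] insert.prems(1)[OF that, of j] by (auto simp: W'_def)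
    have W'sym: "W' a b = W' b a" if "a \<in> J" "b \<in> J" for a b
      using that insert.prems(1) by (simp add: W'_def)
    have W'psd: "0 \<le> (\<Sum>a\<in>J. \<Sum>b\<in>J. W' a b * g a * g b)" for g
      unfolding W'_def
      by (rule psd_Schur_complement) (use insert.hyps insert.prems(1,2) in blast)+
    note IH = insert.IH[of W', OF W'sym W'psd G_J]
    define S where "S = (\<Sum>a\<in>insert j J. \<Sum>b\<in>insert j J. G a b * W a j * W b j)"
    have jj: "0 \<le> W j j"
      using insert.prems(2)[of "\<lambda>a. of_bool (a = j)"] quadratic_form_unit[of "insert j J" j W]
        insert.hyps by simp
    have S: "0 \<le> S" unfolding S_def by (rule insert.prems(3))
    have split: "(\<Sum>a\<in>insert j J. \<Sum>b\<in>insert j J. W a b * G a b) =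
        (\<Sum>a\<in>J. \<Sum>b\<in>J. W' a b * G a b) + S / W j j"
    proof -
      have "(\<Sum>a\<in>insert j J. \<Sum>b\<in>insert j J. W a b * G a b) =
          (\<Sum>a\<in>insert j J. \<Sum>b\<in>insert j J. W' a b * G a b + (G a b * W a j * W b j) / W j j)"
        using insert.prems(1) by (intro sum.cong refl) (auto simp: W'_def algebra_simps)
      also have "\<dots> = (\<Sum>a\<in>insert j J. \<Sum>b\<in>insert j J. W' a b * G a b) + S / W j j"
        by (simp only: S_def sum.distrib sum_divide_distrib)
      also have "(\<Sum>a\<in>insert j J. \<Sum>b\<in>insert j J. W' a b * G a b) = (\<Sum>a\<in>J. \<Sum>b\<in>J. W' a b * G a b)"
        using insert.hyps W'0 by simp
      finally show ?thesis .
    qed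
    have nn: "0 \<le> S / W j j" using S jj by simp
    show ?case
    proof (intro conjI impI)
      show "0 \<le> (\<Sum>a\<in>insert j J. \<Sum>b\<in>insert j J. W a b * G a b)"
        using split nn IH[THEN conjunct1] by linarith
    next
      assume pd: "\<forall>g. (\<exists>a\<in>insert j J. g a \<noteq> 0) \<longrightarrow>
          0 < (\<Sum>a\<in>insert j J. \<Sum>b\<in>insert j J. G a b * g a * g b)"
        and zero: "(\<Sum>a\<in>insert j J. \<Sum>b\<in>insert j J. W a b * G a b) = 0"
      have parts: "(\<Sum>a\<in>J. \<Sum>b\<in>J. W' a b * G a b) = 0" "S / W j j = 0"
        using split nn IH[THEN conjunct1] zero by linarith+
      \<comment> \<open>\<open>S\<close> is the form of \<open>G\<close> at column \<open>j\<close>,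
        which is a nonzero test vector as soon as its own entry \<open>W j j\<close> is
        nonzero.\<close>
      have wjj: "W j j = 0"
      proof (rule ccontr)
        assume "W j j \<noteq> 0"
        then have "\<exists>a\<in>insert j J. W a j \<noteq> 0" by blast
        then have "0 < S" unfolding S_def by (rule pd[THEN spec, THEN mp])
        with parts(2) \<open>W j j \<noteq> 0\<close> show False by simp
      qed
      have "0 < (\<Sum>a\<in>J. \<Sum>b\<in>J. G a b * g a * g b)" if g: "\<exists>a\<in>J. g a \<noteq> 0" for g
      proof -
        have "\<exists>a\<in>insert j J. (g(j := 0)) a \<noteq> 0" using g insert.hyps by auto
        then have "0 < (\<Sum>a\<in>insert j J. \<Sum>b\<in>insert j J. G a b * (g(j := 0)) a * (g(j := 0)) b)"
          by (rule pd[THEN spec, THEN mp])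
        then show ?thesis by (simp only: restr)
      qed
      then have "\<forall>a\<in>J. \<forall>b\<in>J. W' a b = 0"
        using IH[THEN conjunct2, THEN mp, THEN mp] parts(1) by simp
      then have "\<forall>a\<in>J. \<forall>b\<in>J. W a b = 0" using wjj by (simp add: W'_def)
      then show "\<forall>a\<in>insert j J. \<forall>b\<in>insert j J. W a b = 0"
        using row[OF wjj] insert.prems(1)[of _ j] by auto
    qed
  qed
  then show "0 \<le> (\<Sum>a\<in>J. \<Sum>b\<in>J. W a b * G a b)"
    "(\<And>g. (\<exists>a\<in>J. g a \<noteq> 0) \<Longrightarrow> 0 < (\<Sum>a\<in>J. \<Sum>b\<in>J. G a b * g a * g b)) \<Longrightarrow>
       (\<Sum>a\<in>J. \<Sum>b\<in>J. W a b * G a b) = 0 \<Longrightarrow> \<forall>a\<in>J. \<forall>b\<in>J. W a b = 0"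
    by blast+
qed

text \<open>Each product of two coordinates is at most the squared norm in absolute value. This
  crude constant is what makes the identity an order unit.\<close>

lemma quadratic_form_bound:
  fixes x :: "nat \<Rightarrow> nat \<Rightarrow> real"
  shows "(\<Sum>a<n. \<Sum>b<n. x a b * g a * g b) \<le> (\<Sum>a<n. \<Sum>b<n. \<bar>x a b\<bar>) * (\<Sum>a<n. g a * g a)"
proof -
  define N where "N = (\<Sum>a<n. g a * g a)"
  have "(\<Sum>a<n. \<Sum>b<n. x a b * g a * g b) \<le> (\<Sum>a<n. \<Sum>b<n. \<bar>x a b\<bar> * N)"
  proof (intro sum_mono)
    fix a b assume ab: "a \<in> {..<n}" "b \<in> {..<n}"
    have le: "g c * g c \<le> N" if "c \<in> {..<n}" for c
      unfolding N_def using member_le_sum[OF that, of "\<lambda>a. g a * g a"] by simp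
    have "2 * \<bar>g a * g b\<bar> \<le> g a * g a + g b * g b"
      using sum_squares_bound[of "\<bar>g a\<bar>" "\<bar>g b\<bar>"] by (simp add: power2_eq_square abs_mult)
    then have "\<bar>g a * g b\<bar> \<le> N" using le[OF ab(1)] le[OF ab(2)] by linarith
    then have "\<bar>x a b\<bar> * \<bar>g a * g b\<bar> \<le> \<bar>x a b\<bar> * N" by (intro mult_left_mono) auto
    moreover have "x a b * g a * g b \<le> \<bar>x a b\<bar> * \<bar>g a * g b\<bar>"
      using abs_ge_self[of "x a b * (g a * g b)"] by (simp add: abs_mult mult.assoc)
    ultimately show "x a b * g a * g b \<le> \<bar>x a b\<bar> * N" by linarith
  qed
  then show ?thesis by (simp add: N_def sum_distrib_right)
qed

text \<open>With \<open>K\<close> the semidefinite arrays minus \<open>H\<close>, nonnegativity on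
  \<open>K\<close> says at once that the weights are semidefinite on each block and nonpositive on
  \<open>H\<close>. The assumption \<open>none\<close> says exactly that minus the identity is
  outside \<open>K\<close>; as \<open>H\<close> is a cone, dominating the identity means the same as
  being uniformly positive definite.\<close>

lemma psd_alternative:
  fixes k :: "nat \<Rightarrow> nat" and H :: "(nat \<Rightarrow> nat \<Rightarrow> nat \<Rightarrow> real) set"
  assumes zero: "(\<lambda>i a b. 0) \<in> H"
    and add: "\<And>h h'. h \<in> H \<Longrightarrow> h' \<in> H \<Longrightarrow> (\<lambda>i a b. h i a b + h' i a b) \<in> H"
    and scale: "\<And>c h. 0 < c \<Longrightarrow> h \<in> H \<Longrightarrow> (\<lambda>i a b. c * h i a b) \<in> H"
    and none: "\<And>h. h \<in> H \<Longrightarrow> \<exists>i<p. \<exists>g. (\<Sum>a<k i. \<Sum>b<k i. h i a b * g a * g b) < (\<Sum>a<k i. g a * g a)"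
  shows "\<exists>w. (\<forall>h\<in>H. (\<Sum>i<p. \<Sum>a<k i. \<Sum>b<k i. w i a b * h i a b) \<le> 0) \<and>
             (\<forall>i<p. \<forall>g. 0 \<le> (\<Sum>a<k i. \<Sum>b<k i. w i a b * g a * g b)) \<and>
             1 \<le> (\<Sum>i<p. \<Sum>a<k i. w i a a)"
proof -
  define J where "J = (SIGMA i:{..<p}. {..<k i} \<times> {..<k i})"
  define K where "K = {x. \<exists>h\<in>H. \<forall>i<p. \<forall>g. 0 \<le> (\<Sum>a<k i. \<Sum>b<k i. (x (i, a, b) + h i a b) * g a * g b)}"
  define e :: "nat \<times> nat \<times> nat \<Rightarrow> real" where "e = (\<lambda>(i, a, b). of_bool (i < p \<and> a < k i \<and> a = b))"
  have finJ: "finite J" by (simp add: J_def)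
  have sumJ: "sum F J = (\<Sum>i<p. \<Sum>a<k i. \<Sum>b<k i. F (i, a, b))" for F :: "nat \<times> nat \<times> nat \<Rightarrow> real"
    unfolding J_def sum.cartesian_product by (subst sum.Sigma) (auto simp: case_prod_unfold)
  have e_form: "(\<Sum>a<k i. \<Sum>b<k i. e (i, a, b) * F a b) = (\<Sum>a<k i. F a a)"
    if "i < p" for i and F :: "nat \<Rightarrow> nat \<Rightarrow> real"
  proof -
    have "(\<Sum>b<k i. e (i, a, b) * F a b) = (\<Sum>b<k i. if b = a then F a b else 0)" if "a < k i" for a
      using that \<open>i < p\<close> by (intro sum.cong) (auto simp: e_def)
    then show ?thesis by (intro sum.cong refl) simp
  qed
  have e_form2: "(\<Sum>a<k i. \<Sum>b<k i. e (i, a, b) * g a * g b) = (\<Sum>a<k i. g a * g a)"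
    if "i < p" for i and g :: "nat \<Rightarrow> real"
    using e_form[OF that, of "\<lambda>a b. g a * g b"] by (simp add: mult.assoc)
  have KI: "x \<in> K" if "\<And>i g. i < p \<Longrightarrow> 0 \<le> (\<Sum>a<k i. \<Sum>b<k i. x (i, a, b) * g a * g b)" for x
    unfolding K_def using that by (intro CollectI bexI[OF _ zero]) simp
  have "\<exists>w. (\<forall>x\<in>K. (\<forall>j. j \<notin> J \<longrightarrow> x j = 0) \<longrightarrow> 0 \<le> (\<Sum>j\<in>J. w j * x j)) \<and>
      1 \<le> (\<Sum>j\<in>J. w j * e j)"
  proof (rule order_unit_functional[OF finJ])
    show "(\<lambda>j. 0) \<in> K" by (rule KI) simp
  next
    fix x y assume "x \<in> K" "y \<in> K"
    then obtain h h' where hH: "h \<in> H" "h' \<in> H"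
      and h: "\<And>i g. i < p \<Longrightarrow> 0 \<le> (\<Sum>a<k i. \<Sum>b<k i. (x (i, a, b) + h i a b) * g a * g b)"
        "\<And>i g. i < p \<Longrightarrow> 0 \<le> (\<Sum>a<k i. \<Sum>b<k i. (y (i, a, b) + h' i a b) * g a * g b)"
      unfolding K_def by blast
    have "0 \<le> (\<Sum>a<k i. \<Sum>b<k i. (x (i, a, b) + y (i, a, b) + (h i a b + h' i a b)) * g a * g b)"
      if "i < p" for i g
    proof -
      have "(\<Sum>a<k i. \<Sum>b<k i. (x (i, a, b) + y (i, a, b) + (h i a b + h' i a b)) * g a * g b) =
          (\<Sum>a<k i. \<Sum>b<k i. (x (i, a, b) + h i a b) * g a * g b) +
          (\<Sum>a<k i. \<Sum>b<k i. (y (i, a, b) + h' i a b) * g a * g b)"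
        unfolding sum.distrib[symmetric] by (intro sum.cong refl) (simp add: algebra_simps)
      also have "0 \<le> \<dots>" by (intro add_nonneg_nonneg h that)
      finally show ?thesis .
    qed
    then show "(\<lambda>j. x j + y j) \<in> K"
      unfolding K_def by (intro CollectI bexI[OF _ add[OF hH]] allI impI)
  next
    fix c :: real and x assume c: "0 < c" and "x \<in> K"
    then obtain h where hH: "h \<in> H"
      and h: "\<And>i g. i < p \<Longrightarrow> 0 \<le> (\<Sum>a<k i. \<Sum>b<k i. (x (i, a, b) + h i a b) * g a * g b)"
      unfolding K_def by blast
    have "0 \<le> (\<Sum>a<k i. \<Sum>b<k i. (c * x (i, a, b) + c * h i a b) * g a * g b)"
      if "i < p" for i g
    proof -
      have "0 \<le> c * (\<Sum>a<k i. \<Sum>b<k i. (x (i, a, b) + h i a b) * g a * g b)"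
        using c h[OF that] by simp
      then show ?thesis by (simp add: sum_distrib_left algebra_simps)
    qed
    then show "(\<lambda>j. c * x j) \<in> K"
      unfolding K_def by (intro CollectI bexI[OF _ scale[OF c hH]] allI impI)
  next
    fix x :: "nat \<times> nat \<times> nat \<Rightarrow> real"
    \<comment> \<open>Summing over all blocks gives one multiple of the identity that serves every
      block simultaneously.\<close>
    define r where "r = (\<Sum>i<p. \<Sum>a<k i. \<Sum>b<k i. \<bar>x (i, a, b)\<bar>)"
    have "(\<lambda>j. r * e j - x j) \<in> K"
    proof (rule KI)
      fix i g assume i: "i < p"
      define N where "N = (\<Sum>a<k i. g a * g a :: real)"
      have N0: "0 \<le> N" by (simp add: N_def sum_nonneg)
      have "(\<Sum>a<k i. \<Sum>b<k i. x (i, a, b) * g a * g b) \<le> (\<Sum>a<k i. \<Sum>b<k i. \<bar>x (i, a, b)\<bar>) * N"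
        unfolding N_def by (rule quadratic_form_bound)
      also have "\<dots> \<le> r * N"
        unfolding r_def using i N0
        by (intro mult_right_mono member_le_sum[of i "{..<p}" "\<lambda>i. \<Sum>a<k i. \<Sum>b<k i. \<bar>x (i, a, b)\<bar>"])
          (auto intro!: sum_nonneg)
      also have "r * N = (\<Sum>a<k i. \<Sum>b<k i. r * e (i, a, b) * g a * g b)"
        using e_form2[OF i, of g] by (simp add: N_def sum_distrib_left mult.assoc flip: sum_distrib_left)
      finally show "0 \<le> (\<Sum>a<k i. \<Sum>b<k i. (r * e (i, a, b) - x (i, a, b)) * g a * g b)"
        by (simp add: left_diff_distrib sum_subtractf)
    qed
    then show "\<exists>r. (\<lambda>j. r * e j - x j) \<in> K" by blast
  next
    show "(\<lambda>j. - e j) \<notin> K"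
    proof
      assume "(\<lambda>j. - e j) \<in> K"
      then obtain h where h: "h \<in> H"
        and pos: "\<And>i g. i < p \<Longrightarrow> 0 \<le> (\<Sum>a<k i. \<Sum>b<k i. (- e (i, a, b) + h i a b) * g a * g b)"
        unfolding K_def by blast
      obtain i g where i: "i < p" and less: "(\<Sum>a<k i. \<Sum>b<k i. h i a b * g a * g b) < (\<Sum>a<k i. g a * g a)"
        using none[OF h] by blast
      have "(\<Sum>a<k i. \<Sum>b<k i. (- e (i, a, b) + h i a b) * g a * g b) =
          (\<Sum>a<k i. \<Sum>b<k i. h i a b * g a * g b) - (\<Sum>a<k i. \<Sum>b<k i. e (i, a, b) * g a * g b)"
        by (simp add: sum_subtractf[symmetric] algebra_simps)
      then show False using pos[OF i, of g] less e_form2[OF i, of g] by simp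
    qed
  next
    show "e j = 0" if "j \<notin> J" for j
      using that by (cases j) (auto simp: e_def J_def)
  qed
  then obtain w where w: "\<And>x. x \<in> K \<Longrightarrow> (\<And>j. j \<notin> J \<Longrightarrow> x j = 0) \<Longrightarrow> 0 \<le> (\<Sum>j\<in>J. w j * x j)"
    and we: "1 \<le> (\<Sum>j\<in>J. w j * e j)" by blast
  show ?thesis
  proof (intro exI[of _ "\<lambda>i a b. w (i, a, b)"] conjI ballI allI impI)
    fix h assume h: "h \<in> H"
    \<comment> \<open>The functional only controls arrays supported on \<open>J\<close>, so - h is
      cut down to \<open>J\<close>. Inside the blocks x + h is zero, hence \<open>h\<close> itself
      witnesses membership in \<open>K\<close>.\<close>
    define x where "x = (\<lambda>(i, a, b). if (i, a, b) \<in> J then - h i a b else 0)"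
    have "x \<in> K"
      unfolding K_def
    proof (intro CollectI bexI[OF _ h] allI impI)
      fix i g assume "i < p"
      then have "(\<Sum>a<k i. \<Sum>b<k i. (x (i, a, b) + h i a b) * g a * g b) = (\<Sum>a<k i. \<Sum>b<k i. 0)"
        by (intro sum.cong) (auto simp: x_def J_def)
      then show "0 \<le> (\<Sum>a<k i. \<Sum>b<k i. (x (i, a, b) + h i a b) * g a * g b)" by simp
    qed
    then have "0 \<le> (\<Sum>j\<in>J. w j * x j)" by (rule w) (auto simp: x_def)
    also have "(\<Sum>j\<in>J. w j * x j) = (\<Sum>j\<in>J. - (case j of (i, a, b) \<Rightarrow> w (i, a, b) * h i a b))"
      by (intro sum.cong) (auto simp: x_def)
    finally show "(\<Sum>i<p. \<Sum>a<k i. \<Sum>b<k i. w (i, a, b) * h i a b) \<le> 0"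
      by (simp add: sum_negf sumJ)
  next
    fix i g assume i: "i < p"
    \<comment> \<open>The rank-one array of \<open>g\<close> in block \<open>i\<close> and zero
      elsewhere: its forms are squares, and its pairing with \<open>w\<close> is the form of
      \<open>w\<close> at \<open>g\<close>.\<close>
    define x where "x = (\<lambda>(i', a, b). if (i', a, b) \<in> J \<and> i' = i then g a * g b :: real else 0)"
    have "x \<in> K"
    proof (rule KI)
      fix i' g' assume i': "i' < p"
      show "0 \<le> (\<Sum>a<k i'. \<Sum>b<k i'. x (i', a, b) * g' a * g' b)"
      proof (cases "i' = i")
        case True
        have "(\<Sum>a<k i'. \<Sum>b<k i'. x (i', a, b) * g' a * g' b) =
            (\<Sum>a<k i'. \<Sum>b<k i'. (g a * g' a) * (g b * g' b))"
          using True i by (intro sum.cong) (auto simp: x_def J_def)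
        also have "\<dots> = (\<Sum>a<k i'. g a * g' a) * (\<Sum>a<k i'. g a * g' a)"
          by (simp add: sum_product)
        finally show ?thesis by simp
      qed (simp add: x_def)
    qed
    then have "0 \<le> (\<Sum>j\<in>J. w j * x j)" by (rule w) (auto simp: x_def)
    also have "\<dots> = (\<Sum>i'<p. if i' = i then (\<Sum>a<k i'. \<Sum>b<k i'. w (i', a, b) * g a * g b) else 0)"
      unfolding sumJ by (intro sum.cong) (auto simp: x_def J_def intro!: sum.cong sum.neutral)
    finally show "0 \<le> (\<Sum>a<k i. \<Sum>b<k i. w (i, a, b) * g a * g b)"
      using i by simp
  next
    have "(\<Sum>j\<in>J. w j * e j) = (\<Sum>i<p. \<Sum>a<k i. w (i, a, a))"
      unfolding sumJ
    proof (rule sum.cong[OF refl])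
      fix i assume "i \<in> {..<p}"
      then show "(\<Sum>a<k i. \<Sum>b<k i. w (i, a, b) * e (i, a, b)) = (\<Sum>a<k i. w (i, a, a))"
        using e_form[of i "\<lambda>a b. w (i, a, b)"] by (simp add: mult.commute)
    qed
    then show "1 \<le> (\<Sum>i<p. \<Sum>a<k i. w (i, a, a))" using we by simp
  qed
qed

subsection \<open>Symmetric matrices in coordinates\<close>

lemma sym_matsI:
  "X \<in> carrier_mat n n \<Longrightarrow> (\<And>i j. i < n \<Longrightarrow> j < n \<Longrightarrow> X $$ (i, j) = X $$ (j, i)) \<Longrightarrow> X \<in> sym_mats n"
  unfolding sym_mats_def by (auto intro!: eq_matI)

lemma sym_mats_sym:
  assumes "X \<in> sym_mats n" "i < n" "j < n" shows "X $$ (i, j) = X $$ (j, i)"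
proof -
  have "X \<in> carrier_mat n n" using assms by (simp add: sym_mats_def)
  then have "X\<^sup>T $$ (i, j) = X $$ (j, i)" using assms(2,3) by simp
  then show ?thesis using assms by (simp add: sym_mats_def)
qed

lemma sym_mats_carrier: "X \<in> sym_mats n \<Longrightarrow> X \<in> carrier_mat n n"
  by (simp add: sym_mats_def)

lemma sym_mats_dim: "X \<in> sym_mats n \<Longrightarrow> dim_row X = n" "X \<in> sym_mats n \<Longrightarrow> dim_col X = n"
  by (auto simp: sym_mats_def)

lemma sym_mats_add: "X \<in> sym_mats n \<Longrightarrow> Y \<in> sym_mats n \<Longrightarrow> X + Y \<in> sym_mats n"
  by (rule sym_matsI) (auto simp: sym_mats_dim sym_mats_sym)

lemma sym_mats_smult: "X \<in> sym_mats n \<Longrightarrow> c \<cdot>\<^sub>m X \<in> sym_mats n"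
  by (rule sym_matsI) (auto simp: sym_mats_dim sym_mats_sym)

lemma quadratic_form_mat:
  fixes X :: "real mat"
  assumes "X \<in> carrier_mat n n"
  shows "vec n g \<bullet> (X *\<^sub>v vec n g) = (\<Sum>a<n. \<Sum>b<n. X $$ (a, b) * g a * g b)"
  using assms
  by (auto simp: scalar_prod_def mult_mat_vec_def sum_distrib_left lessThan_atLeast0 mult_ac intro!: sum.cong)

text \<open>Test vectors become arbitrary functions, of which only the values below \<open>n\<close>
  matter; this connects matrices with the coordinate sums of the separation.\<close>

lemma psd_mats_iff:
  "X \<in> psd_mats n \<longleftrightarrow> X \<in> sym_mats n \<and> (\<forall>g. 0 \<le> (\<Sum>a<n. \<Sum>b<n. X $$ (a, b) * g a * g b))"
proof -
  have "(\<forall>v\<in>carrier_vec n. 0 \<le> v \<bullet> (X *\<^sub>v v)) \<longleftrightarrow>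
      (\<forall>g. 0 \<le> (\<Sum>a<n. \<Sum>b<n. X $$ (a, b) * g a * g b))" if X: "X \<in> sym_mats n"
  proof (intro iffI allI ballI)
    fix g assume "\<forall>v\<in>carrier_vec n. 0 \<le> v \<bullet> (X *\<^sub>v v)"
    then have "0 \<le> vec n g \<bullet> (X *\<^sub>v vec n g)" by simp
    then show "0 \<le> (\<Sum>a<n. \<Sum>b<n. X $$ (a, b) * g a * g b)"
      by (simp only: quadratic_form_mat[OF sym_mats_carrier[OF X]])
  next
    fix v :: "real Matrix.vec"
    assume pos: "\<forall>g. 0 \<le> (\<Sum>a<n. \<Sum>b<n. X $$ (a, b) * g a * g b)" and v: "v \<in> carrier_vec n"
    have "v = vec n (($) v)" using v by auto
    moreover have "0 \<le> vec n (($) v) \<bullet> (X *\<^sub>v vec n (($) v))"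
      by (simp only: quadratic_form_mat[OF sym_mats_carrier[OF X]] pos)
    ultimately show "0 \<le> v \<bullet> (X *\<^sub>v v)" by simp
  qed
  then show ?thesis by (auto simp: psd_mats_def)
qed

lemma pd_mats_pos:
  assumes "X \<in> pd_mats n" "\<exists>a\<in>{..<n}. g a \<noteq> 0"
  shows "0 < (\<Sum>a<n. \<Sum>b<n. X $$ (a, b) * g a * g b)"
proof -
  have "vec n g \<noteq> 0\<^sub>v n" using assms(2) by (auto simp: vec_eq_iff)
  then show ?thesis
    using assms quadratic_form_mat[of X n g] unfolding pd_mats_def by (auto simp: sym_mats_carrier)
qed

lemma pd_mats_psd: "X \<in> pd_mats n \<Longrightarrow> X \<in> psd_mats n"
proof -
  assume X: "X \<in> pd_mats n"
  have "0 \<le> v \<bullet> (X *\<^sub>v v)" if "v \<in> carrier_vec n" for v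
    using X that by (cases "v = 0\<^sub>v n") (force simp: pd_mats_def sym_mats_def)+
  then show ?thesis using X by (simp add: pd_mats_def psd_mats_def)
qed

lemma frob_carrier:
  "W \<in> carrier_mat n n \<Longrightarrow> frob W X = (\<Sum>a<n. \<Sum>b<n. W $$ (a, b) * X $$ (a, b))"
  by (auto simp: frob_def)

lemma frob_add:
  "\<lbrakk>W \<in> carrier_mat n n; X \<in> carrier_mat n n; Y \<in> carrier_mat n n\<rbrakk> \<Longrightarrow> frob W (X + Y) = frob W X + frob W Y"
  by (simp add: frob_carrier sum.distrib distrib_left)

lemma frob_smult:
  "\<lbrakk>W \<in> carrier_mat n n; X \<in> carrier_mat n n\<rbrakk> \<Longrightarrow> frob W (c \<cdot>\<^sub>m X) = c * frob W X"
  by (simp add: frob_carrier sum_distrib_left algebra_simps)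

lemma frob_smult_left:
  "W \<in> carrier_mat n n \<Longrightarrow> frob (c \<cdot>\<^sub>m W) X = c * frob W X"
  by (simp add: frob_carrier[of _ n] sum_distrib_left algebra_simps)

lemma frob_commute:
  "W \<in> carrier_mat n n \<Longrightarrow> X \<in> carrier_mat n n \<Longrightarrow> frob W X = frob X W"
  by (simp add: frob_carrier mult.commute)

lemma frob_psd_nonneg:
  assumes W: "W \<in> psd_mats n" and X: "X \<in> psd_mats n" shows "0 \<le> frob W X"
proof -
  have sym: "W \<in> sym_mats n" using W by (simp add: psd_mats_iff)
  have "0 \<le> (\<Sum>a<n. \<Sum>b<n. W $$ (a, b) * X $$ (a, b))"
  proof (rule psd_pairing_nonneg)
    show "W $$ (a, b) = W $$ (b, a)" if "a \<in> {..<n}" "b \<in> {..<n}" for a b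
      using sym that by (intro sym_mats_sym) auto
  qed (use W X in \<open>simp_all add: psd_mats_iff\<close>)
  then show ?thesis by (simp only: frob_carrier[OF sym_mats_carrier[OF sym]])
qed

lemma frob_pd_zero:
  assumes W: "W \<in> psd_mats n" and X: "X \<in> pd_mats n" and zero: "frob W X = 0" and ab: "a < n" "b < n"
  shows "W $$ (a, b) = 0"
proof -
  have sym: "W \<in> sym_mats n" using W by (simp add: psd_mats_iff)
  have "\<forall>a\<in>{..<n}. \<forall>b\<in>{..<n}. W $$ (a, b) = 0"
  proof (rule psd_pairing_zero)
    show "W $$ (a, b) = W $$ (b, a)" if "a \<in> {..<n}" "b \<in> {..<n}" for a b
      using sym that by (intro sym_mats_sym) auto
    show "(\<Sum>a<n. \<Sum>b<n. W $$ (a, b) * X $$ (a, b)) = 0"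
      using zero by (simp only: frob_carrier[OF sym_mats_carrier[OF sym]])
    show "0 < (\<Sum>a<n. \<Sum>b<n. X $$ (a, b) * g a * g b)" if "\<exists>a\<in>{..<n}. g a \<noteq> 0" for g
      using X that by (rule pd_mats_pos)
  qed (use W pd_mats_psd[OF X] in \<open>simp_all add: psd_mats_iff\<close>)
  then show ?thesis using ab by auto
qed

section \<open>Linear functionals on symmetric matrices and their coordinates\<close>

definition sym_functional :: "nat \<Rightarrow> (real mat \<Rightarrow> real) \<Rightarrow> bool" where
  "sym_functional n \<phi> \<longleftrightarrow>
     (\<forall>X\<in>sym_mats n. \<forall>Y\<in>sym_mats n. \<phi> (X + Y) = \<phi> X + \<phi> Y) \<and>
     (\<forall>X\<in>sym_mats n. \<forall>c. \<phi> (c \<cdot>\<^sub>m X) = c * \<phi> X)"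

text \<open>Finite combinations are written entrywise because the matrix type has no sum operator of
  fixed dimension. Fisher matrices, convex hulls and basis expansions all have this shape.\<close>

lemma sym_functional_combination:
  assumes \<phi>: "sym_functional n \<phi>" and S: "finite S" and Y: "\<And>s. s \<in> S \<Longrightarrow> Y s \<in> sym_mats n"
  shows "\<phi> (mat n n (\<lambda>(i, j). \<Sum>s\<in>S. c s * Y s $$ (i, j))) = (\<Sum>s\<in>S. c s * \<phi> (Y s))"
  using S Y
proof (induction S)
  case empty
  have "mat n n (\<lambda>(i, j). \<Sum>s\<in>{}. c s * Y s $$ (i, j)) = 0 \<cdot>\<^sub>m 0\<^sub>m n n" by (auto intro!: eq_matI)
  moreover have "\<phi> (0 \<cdot>\<^sub>m 0\<^sub>m n n) = 0 * \<phi> (0\<^sub>m n n)"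
    using \<phi> sym_matsI[of "0\<^sub>m n n" n] unfolding sym_functional_def by fastforce
  ultimately show ?case by (simp only: sum.empty mult_zero_left)
next
  case (insert s S)
  let ?M = "mat n n (\<lambda>(i, j). \<Sum>s\<in>S. c s * Y s $$ (i, j))"
  have M: "?M \<in> sym_mats n"
    using sym_mats_sym[OF insert.prems] by (intro sym_matsI) (auto intro!: sum.cong)
  have Ys: "Y s \<in> sym_mats n" using insert.prems by simp
  have "mat n n (\<lambda>(i, j). \<Sum>s\<in>insert s S. c s * Y s $$ (i, j)) = c s \<cdot>\<^sub>m Y s + ?M"
    using insert.hyps Ys by (auto intro!: eq_matI simp: sym_mats_dim)
  then have "\<phi> (mat n n (\<lambda>(i, j). \<Sum>s\<in>insert s S. c s * Y s $$ (i, j))) = \<phi> (c s \<cdot>\<^sub>m Y s + ?M)"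
    by (rule arg_cong)
  also have "\<dots> = c s * \<phi> (Y s) + \<phi> ?M"
    using \<phi> M Ys sym_mats_smult[OF Ys] unfolding sym_functional_def by simp
  also have "\<phi> ?M = (\<Sum>s\<in>S. c s * \<phi> (Y s))" using insert.prems by (intro insert.IH) simp
  finally show ?case by (simp only: sum.insert[OF insert.hyps])
qed

text \<open>Linearity is only known on symmetric matrices, so the functional is evaluated on
  symmetrized unit matrices; the two halves add up to 1 on the diagonal, and a symmetric
  \<open>X\<close> is the combination of them with its own entries as coefficients.\<close>

lemma sym_functional_coords:
  assumes \<phi>: "sym_functional n \<phi>"
  shows "\<exists>\<gamma>. \<forall>X\<in>sym_mats n. \<phi> X = (\<Sum>a<n. \<Sum>b<n. \<gamma> a b * X $$ (a, b))"
proof -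
  define E :: "nat \<times> nat \<Rightarrow> real mat" where
    "E s = mat n n (\<lambda>(i, j). (if s = (i, j) then 1 / 2 else 0) + (if s = (j, i) then 1 / 2 else 0))" for s
  have E: "E s \<in> sym_mats n" for s
    unfolding E_def by (rule sym_matsI) (auto simp only: index_mat mat_carrier split add.commute)
  show ?thesis
  proof (intro exI[of _ "\<lambda>a b. \<phi> (E (a, b))"] ballI)
    fix X assume X: "X \<in> sym_mats n"
    have "X = mat n n (\<lambda>(i, j). \<Sum>s\<in>{..<n} \<times> {..<n}. X $$ s * E s $$ (i, j))"
    proof (rule eq_matI)
      fix i j
      assume "i < dim_row (mat n n (\<lambda>(i, j). \<Sum>s\<in>{..<n} \<times> {..<n}. X $$ s * E s $$ (i, j)))"
        and "j < dim_col (mat n n (\<lambda>(i, j). \<Sum>s\<in>{..<n} \<times> {..<n}. X $$ s * E s $$ (i, j)))"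
      then have ij: "i < n" "j < n" by auto
      have "(\<Sum>s\<in>{..<n} \<times> {..<n}. X $$ s * E s $$ (i, j)) =
          (\<Sum>s\<in>{..<n} \<times> {..<n}. (if s = (i, j) then X $$ s / 2 else 0) + (if s = (j, i) then X $$ s / 2 else 0))"
      proof (intro sum.cong refl)
        fix s
        have "E s $$ (i, j) = (if s = (i, j) then 1 / 2 else 0) + (if s = (j, i) then 1 / 2 else 0)"
          unfolding E_def using ij by (simp only: index_mat split)
        then show "X $$ s * E s $$ (i, j) =
            (if s = (i, j) then X $$ s / 2 else 0) + (if s = (j, i) then X $$ s / 2 else 0)"
          by (simp only: distrib_left if_distrib[of "(*) (X $$ s)"] mult_zero_right times_divide_eq_right mult_1_right)
      qed
      also have "\<dots> = X $$ (i, j)"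
      proof -
        have delta: "(\<Sum>s\<in>{..<n} \<times> {..<n}. if s = q then X $$ s / 2 else 0) = X $$ q / 2"
          if "q \<in> {..<n} \<times> {..<n}" for q
          using that by (subst sum.delta) auto
        have "(i, j) \<in> {..<n} \<times> {..<n}" "(j, i) \<in> {..<n} \<times> {..<n}" using ij by auto
        then show ?thesis
          using sym_mats_sym[OF X ij] by (simp only: sum.distrib delta field_sum_of_halves)
      qed
      finally show "X $$ (i, j) = mat n n (\<lambda>(i, j). \<Sum>s\<in>{..<n} \<times> {..<n}. X $$ s * E s $$ (i, j)) $$ (i, j)"
        using ij by simp
    qed (use X in \<open>auto simp: sym_mats_dim\<close>)
    then have "\<phi> X = \<phi> (mat n n (\<lambda>(i, j). \<Sum>s\<in>{..<n} \<times> {..<n}. X $$ s * E s $$ (i, j)))"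
      by (rule arg_cong)
    also have "\<dots> = (\<Sum>s\<in>{..<n} \<times> {..<n}. X $$ s * \<phi> (E s))"
      using E by (intro sym_functional_combination \<phi>) auto
    finally have "\<phi> X = (\<Sum>s\<in>{..<n} \<times> {..<n}. X $$ s * \<phi> (E s))" .
    then show "\<phi> X = (\<Sum>a<n. \<Sum>b<n. \<phi> (E (a, b)) * X $$ (a, b))"
      by (simp add: sum.cartesian_product mult.commute case_prod_unfold)
  qed
qed

lemma vec_functional_coords:
  fixes \<psi> :: "real Matrix.vec \<Rightarrow> real"
  assumes add: "\<And>u v. u \<in> carrier_vec l \<Longrightarrow> v \<in> carrier_vec l \<Longrightarrow> \<psi> (u + v) = \<psi> u + \<psi> v"
    and scale: "\<And>u c. u \<in> carrier_vec l \<Longrightarrow> \<psi> (c \<cdot>\<^sub>v u) = c * \<psi> u"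
    and u: "u \<in> carrier_vec l"
  shows "\<psi> u = (\<Sum>j<l. u $ j * \<psi> (unit_vec l j))"
proof -
  have "\<psi> (vec l (\<lambda>j. if j \<in> S then u $ j else 0)) = (\<Sum>j\<in>S. u $ j * \<psi> (unit_vec l j))"
    if "finite S" "S \<subseteq> {..<l}" for S
    using that
  proof (induction S)
    case empty
    have "vec l (\<lambda>j. 0) = 0 \<cdot>\<^sub>v (0\<^sub>v l :: real Matrix.vec)" by auto
    then show ?case using scale[of "0\<^sub>v l" 0] by simp
  next
    case (insert s S)
    let ?v = "vec l (\<lambda>j. if j \<in> S then u $ j else 0)"
    have "vec l (\<lambda>j. if j \<in> insert s S then u $ j else 0) = u $ s \<cdot>\<^sub>v unit_vec l s + ?v"
      using insert.hyps by (auto simp: unit_vec_def)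
    moreover have "\<psi> (u $ s \<cdot>\<^sub>v unit_vec l s + ?v) = u $ s * \<psi> (unit_vec l s) + \<psi> ?v"
      by (subst add) (auto simp: scale)
    ultimately show ?case using insert by simp
  qed
  from this[of "{..<l}"] have "\<psi> (vec l (\<lambda>j. if j \<in> {..<l} then u $ j else 0)) = (\<Sum>j<l. u $ j * \<psi> (unit_vec l j))"
    by simp
  moreover have "vec l (\<lambda>j. if j \<in> {..<l} then u $ j else 0) = u" using u by auto
  ultimately show ?thesis by simp
qed

text \<open>The adjoint is a definite description, so existence and uniqueness have to be supplied.
  Linearity shows that the vector of pairings with images of unit vectors works, and testing with
  unit vectors forces it.\<close>

lemma
  assumes C: "linear_vec_sym l k C" and W: "W \<in> carrier_mat k k"
  shows adjoint_vec_index: "j < l \<Longrightarrow> adjoint_vec l C W $ j = frob W (C (unit_vec l j))"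
    and frob_adjoint_vec: "u \<in> carrier_vec l \<Longrightarrow> frob W (C u) = (\<Sum>j<l. u $ j * adjoint_vec l C W $ j)"
proof -
  have car: "C u \<in> carrier_mat k k" if "u \<in> carrier_vec l" for u
    using C that by (auto simp: linear_vec_sym_def sym_mats_carrier)
  have exp: "frob W (C u) = (\<Sum>j<l. u $ j * frob W (C (unit_vec l j)))" if "u \<in> carrier_vec l" for u
  proof (rule vec_functional_coords[OF _ _ that])
    show "frob W (C (u + v)) = frob W (C u) + frob W (C v)"
      if "u \<in> carrier_vec l" "v \<in> carrier_vec l" for u v
      using C that frob_add[OF W car car, of u v] by (simp add: linear_vec_sym_def)
    show "frob W (C (c \<cdot>\<^sub>v u)) = c * frob W (C u)" if "u \<in> carrier_vec l" for u c
      using C that frob_smult[OF W car, of u c] by (simp add: linear_vec_sym_def)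
  qed
  have "adjoint_vec l C W = vec l (\<lambda>j. frob W (C (unit_vec l j)))"
    unfolding adjoint_vec_def
  proof (rule the_equality)
    show "vec l (\<lambda>j. frob W (C (unit_vec l j))) \<in> carrier_vec l \<and>
      (\<forall>u\<in>carrier_vec l. frob (C u) W = u \<bullet> vec l (\<lambda>j. frob W (C (unit_vec l j))))"
      using exp by (auto simp: scalar_prod_def lessThan_atLeast0 frob_commute[OF car W])
  next
    fix v assume v: "v \<in> carrier_vec l \<and> (\<forall>u\<in>carrier_vec l. frob (C u) W = u \<bullet> v)"
    show "v = vec l (\<lambda>j. frob W (C (unit_vec l j)))"
    proof (rule eq_vecI)
      fix j assume "j < dim_vec (vec l (\<lambda>j. frob W (C (unit_vec l j))))"
      then have j: "j < l" by simp
      then have "v $ j = unit_vec l j \<bullet> v" using v by simp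
      also have "\<dots> = frob W (C (unit_vec l j))" using v frob_commute[OF car W] by simp
      finally show "v $ j = vec l (\<lambda>j. frob W (C (unit_vec l j))) $ j" using j by simp
    qed (use v in auto)
  qed
  then show ind: "j < l \<Longrightarrow> adjoint_vec l C W $ j = frob W (C (unit_vec l j))" for j by simp
  show "u \<in> carrier_vec l \<Longrightarrow> frob W (C u) = (\<Sum>j<l. u $ j * adjoint_vec l C W $ j)"
    by (subst exp) (auto simp: ind intro!: sum.cong)
qed

lemma sym_functional_frob:
  assumes A: "linear_sym m n A" and W: "W \<in> carrier_mat n n"
  shows "sym_functional m (\<lambda>X. frob W (A X))"
proof -
  have "A X \<in> carrier_mat n n" if "X \<in> sym_mats m" for X
    using A that by (simp add: linear_sym_def sym_mats_carrier)
  then show ?thesis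
    using A frob_add[OF W] frob_smult[OF W] by (simp add: sym_functional_def linear_sym_def)
qed

lemma sym_functional_sum:
  "(\<And>i. i \<in> S \<Longrightarrow> sym_functional m (\<phi> i)) \<Longrightarrow> sym_functional m (\<lambda>X. \<Sum>i\<in>S. \<phi> i X)"
  by (simp add: sym_functional_def sum.distrib sum_distrib_left)

lemma sym_functional_quadratic_form:
  "sym_functional n (\<lambda>X. \<Sum>a<n. \<Sum>b<n. X $$ (a, b) * g a * g b)"
  by (simp add: sym_functional_def sym_mats_dim sum.distrib sum_distrib_left algebra_simps)

subsection \<open>Designs\<close>

lemma fisher_point_sym: "fisher_point m f \<omega> t \<in> sym_mats m"
  by (rule sym_matsI) (auto simp: fisher_point_def)

lemma fisher_sym: "fisher m f \<omega> \<xi> \<in> sym_mats m"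
  by (rule sym_matsI) (auto simp: fisher_def mult.commute)

lemma fisher_eq_sum:
  assumes "design I \<xi>"
  shows "fisher m f \<omega> \<xi> =
    mat m m (\<lambda>(i, j). \<Sum>t\<in>set_pmf \<xi>. pmf \<xi> t * fisher_point m f \<omega> t $$ (i, j))"
proof (rule eq_matI)
  fix i j
  assume "i < dim_row (mat m m (\<lambda>(i, j). \<Sum>t\<in>set_pmf \<xi>. pmf \<xi> t * fisher_point m f \<omega> t $$ (i, j)))"
    and "j < dim_col (mat m m (\<lambda>(i, j). \<Sum>t\<in>set_pmf \<xi>. pmf \<xi> t * fisher_point m f \<omega> t $$ (i, j)))"
  moreover have "measure_pmf.expectation \<xi> h = (\<Sum>t\<in>set_pmf \<xi>. h t * pmf \<xi> t)" for h :: "real \<Rightarrow> real"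
    using assms by (intro integral_measure_pmf_real) (auto simp: design_def)
  ultimately show "fisher m f \<omega> \<xi> $$ (i, j) =
      mat m m (\<lambda>(i, j). \<Sum>t\<in>set_pmf \<xi>. pmf \<xi> t * fisher_point m f \<omega> t $$ (i, j)) $$ (i, j)"
    by (simp add: fisher_def fisher_point_def mult.commute)
qed (simp_all add: fisher_def)

lemma sym_functional_fisher:
  assumes "sym_functional m \<phi>" "design I \<xi>"
  shows "\<phi> (fisher m f \<omega> \<xi>) = (\<Sum>t\<in>set_pmf \<xi>. pmf \<xi> t * \<phi> (fisher_point m f \<omega> t))"
  unfolding fisher_eq_sum[OF assms(2)] using assms
  by (intro sym_functional_combination fisher_point_sym) (auto simp: design_def)

lemma design_return: "t \<in> I \<Longrightarrow> design I (return_pmf t)"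
  by (simp add: design_def)

lemma sum_pmf_design: "design I \<xi> \<Longrightarrow> (\<Sum>t\<in>set_pmf \<xi>. pmf \<xi> t) = 1"
  by (rule sum_pmf_eq_1) (auto simp: design_def)

text \<open>At a point the form is omega times a square, and a design averages these. The
  equivalence in \<open>sd_representation\<close> speaks only of semidefinite matrices, so this
  opens it for designs.\<close>

lemma fisher_psd:
  assumes \<xi>: "design I \<xi>" and nonneg: "\<And>t. t \<in> I \<Longrightarrow> 0 \<le> rat_eval \<omega> t"
  shows "fisher m f \<omega> \<xi> \<in> psd_mats m"
  unfolding psd_mats_iff
proof (intro conjI allI fisher_sym)
  fix g
  have "(\<Sum>a<m. \<Sum>b<m. fisher_point m f \<omega> t $$ (a, b) * g a * g b) =
      rat_eval \<omega> t * (\<Sum>a<m. rat_eval (f a) t * g a) * (\<Sum>a<m. rat_eval (f a) t * g a)" for t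
    by (simp add: fisher_point_def sum_product sum_distrib_left algebra_simps)
  moreover have "0 \<le> rat_eval \<omega> t * z * z" if "t \<in> set_pmf \<xi>" for t z
    using nonneg[of t] \<xi> that by (auto simp: mult.assoc design_def)
  ultimately show "0 \<le> (\<Sum>a<m. \<Sum>b<m. fisher m f \<omega> \<xi> $$ (a, b) * g a * g b)"
    unfolding sym_functional_fisher[OF sym_functional_quadratic_form \<xi>]
    by (intro sum_nonneg[of "set_pmf \<xi>"] mult_nonneg_nonneg[OF pmf_nonneg]) simp
qed

lemma mat_convex_hull_sym:
  assumes "X \<in> mat_convex_hull n S" "S \<subseteq> sym_mats n"
  shows "X \<in> sym_mats n"
proof -
  obtain T c where T: "T \<subseteq> S" and X: "X = mat n n (\<lambda>(i, j). \<Sum>Y\<in>T. c Y * Y $$ (i, j))"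
    using assms(1) unfolding mat_convex_hull_def by blast
  have "Y $$ (i, j) = Y $$ (j, i)" if "Y \<in> T" "i < n" "j < n" for Y i j
    using that T assms(2) by (intro sym_mats_sym) auto
  then show ?thesis unfolding X by (intro sym_matsI) (auto intro!: sum.cong)
qed

text \<open>The strictly feasible point is given in the convex hull, not as a design; this carries
  bounds at single points of the region over to it.\<close>

lemma sym_functional_hull_le:
  assumes \<phi>: "sym_functional n \<phi>" and X: "X \<in> mat_convex_hull n S" and S: "S \<subseteq> sym_mats n"
    and le: "\<And>Y. Y \<in> S \<Longrightarrow> \<phi> Y \<le> r"
  shows "\<phi> X \<le> r"
proof -
  obtain T c where T: "finite T" "T \<subseteq> S" "\<forall>Y\<in>T. 0 \<le> c Y" "sum c T = 1"
    and X: "X = mat n n (\<lambda>(i, j). \<Sum>Y\<in>T. c Y * Y $$ (i, j))"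
    using X unfolding mat_convex_hull_def by blast
  have "\<phi> X = (\<Sum>Y\<in>T. c Y * \<phi> Y)"
    unfolding X using T S sym_functional_combination[OF \<phi>, of T "\<lambda>Y. Y"] by blast
  also have "\<dots> \<le> (\<Sum>Y\<in>T. c Y * r)"
    using T le by (intro sum_mono mult_left_mono) auto
  finally show ?thesis using T by (simp flip: sum_distrib_right)
qed

text \<open>Closure of the homogenized cone under addition rests on this: the mixing probability is
  s1 / (s1 + s2), and if both weights vanish the two sides are zero for any design.\<close>

lemma fisher_mixture:
  assumes d: "design I \<xi>1" "design I \<xi>2" and s: "0 \<le> s1" "0 \<le> (s2 :: real)"
  shows "\<exists>\<xi>. design I \<xi> \<and>
    s1 \<cdot>\<^sub>m fisher m f \<omega> \<xi>1 + s2 \<cdot>\<^sub>m fisher m f \<omega> \<xi>2 = (s1 + s2) \<cdot>\<^sub>m fisher m f \<omega> \<xi>"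
proof (cases "s1 + s2 = 0")
  case True
  then have "s1 = 0" "s2 = 0" using s by auto
  then show ?thesis using d by (auto intro!: exI[of _ \<xi>1] eq_matI simp: fisher_def)
next
  case False
  define q where "q = s1 / (s1 + s2)"
  have q: "0 \<le> q" "q \<le> 1" "(s1 + s2) * q = s1" "(s1 + s2) * (1 - q) = s2"
    using s False by (auto simp: q_def field_simps)
  define \<xi> where "\<xi> = bernoulli_pmf q \<bind> (\<lambda>b. if b then \<xi>1 else \<xi>2)"
  have sub: "set_pmf \<xi> \<subseteq> set_pmf \<xi>1 \<union> set_pmf \<xi>2"
    by (auto simp: \<xi>_def split: if_splits)
  have fin: "finite (set_pmf \<xi>1 \<union> set_pmf \<xi>2)" using d by (simp add: design_def)
  have pmf: "pmf \<xi> t = pmf \<xi>1 t * q + pmf \<xi>2 t * (1 - q)" for t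
    using q by (simp add: \<xi>_def pmf_bind)
  have E: "measure_pmf.expectation \<nu> h = (\<Sum>t\<in>set_pmf \<xi>1 \<union> set_pmf \<xi>2. h t * pmf \<nu> t)"
    if "set_pmf \<nu> \<subseteq> set_pmf \<xi>1 \<union> set_pmf \<xi>2" for \<nu> and h :: "real \<Rightarrow> real"
    using that fin by (intro integral_measure_pmf_real) auto
  have mix: "s1 * measure_pmf.expectation \<xi>1 h + s2 * measure_pmf.expectation \<xi>2 h =
      (s1 + s2) * measure_pmf.expectation \<xi> h" for h :: "real \<Rightarrow> real"
  proof -
    have "measure_pmf.expectation \<xi> h =
        q * measure_pmf.expectation \<xi>1 h + (1 - q) * measure_pmf.expectation \<xi>2 h"
      unfolding E[OF sub] E[OF Un_upper1] E[OF Un_upper2] pmf sum_distrib_left sum.distrib[symmetric]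
      by (intro sum.cong refl) (simp add: algebra_simps)
    then have "(s1 + s2) * measure_pmf.expectation \<xi> h =
        ((s1 + s2) * q) * measure_pmf.expectation \<xi>1 h + ((s1 + s2) * (1 - q)) * measure_pmf.expectation \<xi>2 h"
      by (simp only: distrib_left mult.assoc)
    then show ?thesis by (simp only: q)
  qed
  have "design I \<xi>"
    using sub fin finite_subset d unfolding design_def by blast
  moreover have "s1 \<cdot>\<^sub>m fisher m f \<omega> \<xi>1 + s2 \<cdot>\<^sub>m fisher m f \<omega> \<xi>2 = (s1 + s2) \<cdot>\<^sub>m fisher m f \<omega> \<xi>"
    by (rule eq_matI) (auto simp: fisher_def mix)
  ultimately show ?thesis by blast
qed

subsection \<open>The polynomial of a dual point\<close>

text \<open>Multiplying the difference by \<open>L\<close> makes it vanish at every real, so no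
  roots have to be counted.\<close>

lemma poly_eqI_generic:
  fixes L q q' :: "real poly"
  assumes "L \<noteq> 0" "\<And>t. poly L t \<noteq> 0 \<Longrightarrow> poly q t = poly q' t"
  shows "q = q'"
proof -
  have "poly (L * (q - q')) t = 0" for t using assms(2)[of t] by auto
  then have "L * (q - q') = 0" using poly_all_0_iff_0 by blast
  then show ?thesis using assms(1) by simp
qed

text \<open>A definite description has its property only with existence, assumed in
  \<open>ex\<close>, and uniqueness, which the values off the roots of \<open>L\<close>
  provide.\<close>

lemma is_dual_poly_dual_poly:
  assumes L: "L \<noteq> 0" and ex: "\<exists>q. is_dual_poly m f \<omega> L p A D y W q"
  shows "is_dual_poly m f \<omega> L p A D y W (dual_poly m f \<omega> L p A D y W)"
proof -
  obtain q where q: "is_dual_poly m f \<omega> L p A D y W q" using ex by blast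
  have "q' = q" if "is_dual_poly m f \<omega> L p A D y W q'" for q'
    using q that by (intro poly_eqI_generic[OF L]) (simp add: is_dual_poly_def)
  with q show ?thesis unfolding dual_poly_def by (rule theI)
qed

text \<open>A product of denominators, cruder than the lcm but enough for bounding degrees.\<close>

lemma fisher_point_common_denominator:
  "\<exists>Q N. Q \<noteq> 0 \<and> (\<forall>t a b. a < m \<longrightarrow> b < m \<longrightarrow> poly Q t \<noteq> 0 \<longrightarrow>
     poly Q t * fisher_point m f \<omega> t $$ (a, b) = poly (N a b) t)"
proof -
  define P where "P = (\<Prod>a<m. den (f a))"
  define R where "R a = num (f a) * (\<Prod>c\<in>{..<m} - {a}. den (f c))" for a
  have P: "P = den (f a) * (\<Prod>c\<in>{..<m} - {a}. den (f c))" if "a < m" for a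
    unfolding P_def using that by (subst prod.remove[of _ a]) auto
  have den0: "den r \<noteq> 0" for r by (simp add: den_def)
  have clear: "poly P t * rat_eval (f a) t = poly (R a) t" if "a < m" "poly P t \<noteq> 0" for a t
    using that(2) unfolding P[OF that(1)] R_def rat_eval_def by simp
  show ?thesis
  proof (intro exI[of _ "den \<omega> * P * P"] exI[of _ "\<lambda>a b. num \<omega> * R a * R b"] conjI allI impI)
    show "den \<omega> * P * P \<noteq> 0" by (simp add: den0 P_def)
  next
    fix t a b assume ab: "a < m" "b < m" and nz: "poly (den \<omega> * P * P) t \<noteq> 0"
    then have "poly (den \<omega> * P * P) t * fisher_point m f \<omega> t $$ (a, b) =
        (poly (den \<omega>) t * rat_eval \<omega> t) * (poly P t * rat_eval (f a) t) * (poly P t * rat_eval (f b) t)"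
      by (simp add: fisher_point_def algebra_simps)
    also have "\<dots> = poly (num \<omega> * R a * R b) t"
      using ab nz by (simp add: clear) (simp add: rat_eval_def)
    finally show "poly (den \<omega> * P * P) t * fisher_point m f \<omega> t $$ (a, b) = poly (num \<omega> * R a * R b) t" .
  qed
qed

text \<open>\<open>dual_degree\<close> is a maximum over infinitely many (y, W), so the degrees must
  be bounded uniformly. After clearing with \<open>Q\<close>, the variables y and W enter only
  through constant coefficients of the fixed polynomials \<open>Q\<close> and \<open>N a b\<close>,
  whose degrees do not depend on them.\<close>

lemma degree_dual_poly_bounded:
  assumes L: "L \<noteq> 0" and A: "\<And>i. i < p \<Longrightarrow> linear_sym m (k i) (A i)"
    and D: "\<And>i. i < p \<Longrightarrow> D i \<in> sym_mats (k i)"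
  shows "\<exists>K. \<forall>y W q. (\<forall>i<p. W i \<in> psd_mats (k i)) \<longrightarrow> is_dual_poly m f \<omega> L p A D y W q \<longrightarrow> degree q \<le> K"
proof -
  obtain Q N where Q: "Q \<noteq> 0" and N: "\<And>t a b. a < m \<Longrightarrow> b < m \<Longrightarrow> poly Q t \<noteq> 0 \<Longrightarrow>
      poly Q t * fisher_point m f \<omega> t $$ (a, b) = poly (N a b) t"
    using fisher_point_common_denominator by blast
  define K where "K = degree L + (degree Q + (\<Sum>a<m. \<Sum>b<m. degree (N a b)))"
  show ?thesis
  proof (intro exI[of _ K] allI impI)
    fix y W q assume W: "\<forall>i<p. W i \<in> psd_mats (k i)" and q: "is_dual_poly m f \<omega> L p A D y W q"
    have Wc: "W i \<in> carrier_mat (k i) (k i)" if "i < p" for i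
      using W that by (simp add: psd_mats_iff sym_mats_carrier)
    have "sym_functional m (\<lambda>X. \<Sum>i<p. frob (W i) (A i X))"
      using A Wc by (intro sym_functional_sum sym_functional_frob) auto
    then obtain \<gamma> where \<gamma>: "\<And>X. X \<in> sym_mats m \<Longrightarrow>
        (\<Sum>i<p. frob (W i) (A i X)) = (\<Sum>a<m. \<Sum>b<m. \<gamma> a b * X $$ (a, b))"
      using sym_functional_coords by blast
    define \<delta> where "\<delta> = (\<Sum>i<p. frob (W i) (D i))"
    have exp: "(\<Sum>i<p. frob (W i) (A i (fisher_point m f \<omega> t) + D i)) =
        (\<Sum>a<m. \<Sum>b<m. \<gamma> a b * fisher_point m f \<omega> t $$ (a, b)) + \<delta>" for t
    proof -
      have "frob (W i) (A i (fisher_point m f \<omega> t) + D i) =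
          frob (W i) (A i (fisher_point m f \<omega> t)) + frob (W i) (D i)" if "i < p" for i
        using A[OF that] D[OF that] fisher_point_sym[of m f \<omega> t]
        by (intro frob_add[OF Wc[OF that]]) (auto simp: linear_sym_def sym_mats_carrier)
      then show ?thesis
        by (simp add: \<gamma>[OF fisher_point_sym, symmetric] \<delta>_def sum.distrib)
    qed
    define R where "R = Polynomial.smult (y - \<delta>) Q - (\<Sum>a<m. \<Sum>b<m. Polynomial.smult (\<gamma> a b) (N a b))"
    have "q * Q = L * R"
    proof (rule poly_eqI_generic)
      show "L * Q \<noteq> 0" using L Q by simp
    next
      fix t assume "poly (L * Q) t \<noteq> 0"
      then have nz: "poly L t \<noteq> 0" "poly Q t \<noteq> 0" by auto
      have "poly (\<Sum>a<m. \<Sum>b<m. Polynomial.smult (\<gamma> a b) (N a b)) t =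
          poly Q t * (\<Sum>a<m. \<Sum>b<m. \<gamma> a b * fisher_point m f \<omega> t $$ (a, b))"
        using nz(2) by (simp add: poly_sum N[symmetric] sum_distrib_left mult.left_commute)
      then have "poly R t = poly Q t * (y - (\<Sum>i<p. frob (W i) (A i (fisher_point m f \<omega> t) + D i)))"
        unfolding exp R_def by (simp add: algebra_simps)
      moreover have "poly q t = poly L t * (y - (\<Sum>i<p. frob (W i) (A i (fisher_point m f \<omega> t) + D i)))"
        using q nz(1) unfolding is_dual_poly_def by blast
      ultimately show "poly (q * Q) t = poly (L * R) t" by simp
    qed
    have "degree R \<le> degree Q + (\<Sum>a<m. \<Sum>b<m. degree (N a b))"
      unfolding R_def
    proof (intro degree_diff_le degree_sum_le)
      show "degree (Polynomial.smult (y - \<delta>) Q) \<le> degree Q + (\<Sum>a<m. \<Sum>b<m. degree (N a b))"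
        by (rule order_trans[OF degree_smult_le]) simp
    next
      fix a b assume ab: "a \<in> {..<m}" "b \<in> {..<m}"
      have "degree (N a b) \<le> (\<Sum>b<m. degree (N a b))" using ab by (intro member_le_sum) auto
      also have "\<dots> \<le> (\<Sum>a<m. \<Sum>b<m. degree (N a b))"
        using ab by (intro member_le_sum[of a _ "\<lambda>a. \<Sum>b<m. degree (N a b)"]) auto
      finally have "degree (N a b) \<le> (\<Sum>a<m. \<Sum>b<m. degree (N a b))" .
      then show "degree (Polynomial.smult (\<gamma> a b) (N a b)) \<le> degree Q + (\<Sum>a<m. \<Sum>b<m. degree (N a b))"
        using degree_smult_le[of "\<gamma> a b" "N a b"] by linarith
    qed auto
    then have "degree (q * Q) \<le> K"
      unfolding \<open>q * Q = L * R\<close> K_def using degree_mult_le[of L R] by linarith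
    moreover have "degree q \<le> degree (q * Q)"
      using Q by (cases "q = 0") (auto simp: degree_mult_eq)
    ultimately show "degree q \<le> K" by simp
  qed
qed

lemma degree_dual_poly_le_dual_degree:
  assumes L: "L \<noteq> 0" and A: "\<And>i. i < p \<Longrightarrow> linear_sym m (k i) (A i)"
    and D: "\<And>i. i < p \<Longrightarrow> D i \<in> sym_mats (k i)"
    and clears: "\<And>y W. (\<And>i. i < p \<Longrightarrow> W i \<in> psd_mats (k i)) \<Longrightarrow> \<exists>q. is_dual_poly m f \<omega> L p A D y W q"
    and W: "\<And>i. i < p \<Longrightarrow> W i \<in> psd_mats (k i)"
  shows "degree (dual_poly m f \<omega> L p A D y W) \<le> dual_degree m f \<omega> L p k A D"
proof -
  let ?S = "{degree (dual_poly m f \<omega> L p A D y W) | y W. \<forall>i<p. W i \<in> psd_mats (k i)}"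
  obtain K where K: "\<And>y W q. \<forall>i<p. W i \<in> psd_mats (k i) \<Longrightarrow> is_dual_poly m f \<omega> L p A D y W q \<Longrightarrow> degree q \<le> K"
    using degree_dual_poly_bounded[of L p m k A D f \<omega>, OF L A D] by blast
  have "?S \<subseteq> {..K}"
    using K is_dual_poly_dual_poly[OF L clears] by blast
  then have "finite ?S" by (rule finite_subset) simp
  then show ?thesis unfolding dual_degree_def using W by (intro Max_ge) blast+
qed

subsection \<open>Strong duality\<close>

text \<open>The range of each parameter of the cone dictates a dual constraint: \<open>u\<close>
  fills a whole space, so its multiplier vanishes; the level may rise along a half-line, so the
  multiplier of \<open>B\<close> is at most 0; point masses give the bound at each t. Strict
  feasibility makes the multiplier of \<open>B\<close> negative, and rescaling turns it into
  -1.\<close>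

lemma strong_duality:
  assumes adm: "witnesses_admissibility m (mat_convex_hull m (fisher_point m f \<omega> ` I)) \<Phi> p k l A B C D"
    and nonneg: "\<And>t. t \<in> I \<Longrightarrow> 0 \<le> rat_eval \<omega> t"
    and opt: "optimal_design m f \<omega> I \<Phi> \<xi>"
  shows "\<exists>W. (\<forall>i<p. W i \<in> psd_mats (k i)) \<and> (\<Sum>i<p. frob (W i) (B i)) = -1 \<and>
    (\<forall>u\<in>carrier_vec l. (\<Sum>i<p. frob (W i) (C i u)) = 0) \<and>
    (\<forall>t\<in>I. (\<Sum>i<p. frob (W i) (A i (fisher_point m f \<omega> t) + D i)) \<le> \<Phi> (fisher m f \<omega> \<xi>))"
proof -
  let ?F = "fisher m f \<omega>"
  define z where "z = \<Phi> (?F \<xi>)"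
  have rep: "sd_representation m \<Phi> p k l A B C D"
    using adm by (simp add: witnesses_admissibility_def)
  have A: "linear_sym m (k i) (A i)" and B: "B i \<in> sym_mats (k i)"
    and C: "linear_vec_sym l (k i) (C i)" and D: "D i \<in> sym_mats (k i)" if "i < p" for i
    using rep that by (auto simp: sd_representation_def)
  have AX: "A i X \<in> sym_mats (k i)" if "i < p" "X \<in> sym_mats m" for i X
    using A[OF that(1)] that(2) by (simp add: linear_sym_def)
  have Cu: "C i u \<in> sym_mats (k i)" if "i < p" "u \<in> carrier_vec l" for i u
    using C[OF that(1)] that(2) by (simp add: linear_vec_sym_def)
  have lmi_iff: "s \<le> \<Phi> (?F \<nu>) \<longleftrightarrow>
      (\<exists>u\<in>carrier_vec l. \<forall>i<p. lmi (A i) (B i) (C i) (D i) (?F \<nu>) s u \<in> psd_mats (k i))"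
    if "design I \<nu>" for \<nu> s
    using rep fisher_psd[OF that nonneg] unfolding sd_representation_def by blast
  have lmi_sym: "lmi (A i) (B i) (C i) (D i) X s u \<in> sym_mats (k i)"
    if "i < p" "X \<in> sym_mats m" "u \<in> carrier_vec l" for i X s u
    unfolding lmi_def using that by (intro sym_mats_add sym_mats_smult AX B Cu D)
  have lmi_index: "lmi (A i) (B i) (C i) (D i) X s u $$ (a, b) =
      A i X $$ (a, b) + s * B i $$ (a, b) + C i u $$ (a, b) + D i $$ (a, b)"
    if "i < p" "X \<in> sym_mats m" "u \<in> carrier_vec l" "a < k i" "b < k i" for i X s u a b
    using that(4,5)
    by (simp add: lmi_def sym_mats_dim[OF AX[OF that(1,2)]] sym_mats_dim[OF B[OF that(1)]]
      sym_mats_dim[OF Cu[OF that(1,3)]] sym_mats_dim[OF D[OF that(1)]])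
  have \<xi>: "design I \<xi>" and max: "\<And>\<nu>. design I \<nu> \<Longrightarrow> \<Phi> (?F \<nu>) \<le> z"
    using opt by (auto simp: optimal_design_def is_arg_max_linorder z_def)
  obtain u\<xi> where u\<xi>: "u\<xi> \<in> carrier_vec l"
    and lmi\<xi>: "\<And>i. i < p \<Longrightarrow> lmi (A i) (B i) (C i) (D i) (?F \<xi>) z u\<xi> \<in> psd_mats (k i)"
    using lmi_iff[OF \<xi>, of z] by (auto simp: z_def)
  \<comment> \<open>For \<open>s > 0\<close> this is \<open>s\<close> times the matrix inequality at level \<open>z + \<zeta> / s\<close>; \<open>s = 0\<close> gives recession directions.\<close>
  define G where "G s \<zeta> \<nu> u i a b =
      s * A i (?F \<nu>) $$ (a, b) + (s * z + \<zeta>) * B i $$ (a, b) + C i u $$ (a, b) + s * D i $$ (a, b)"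
    for s \<zeta> :: real and \<nu> u i a b
  \<comment> \<open>Only entries inside the blocks are prescribed, because linearity of
    \<open>A\<close> and \<open>C\<close> can be read off entrywise only there.\<close>
  define H where "H = {h. \<exists>s \<zeta> \<nu> u. 0 \<le> s \<and> 0 \<le> \<zeta> \<and> design I \<nu> \<and> u \<in> carrier_vec l \<and>
      (\<forall>i<p. \<forall>a<k i. \<forall>b<k i. h i a b = G s \<zeta> \<nu> u i a b)}"
  have HI: "h \<in> H" if "0 \<le> s" "0 \<le> \<zeta>" "design I \<nu>" "u \<in> carrier_vec l"
      "\<And>i a b. i < p \<Longrightarrow> a < k i \<Longrightarrow> b < k i \<Longrightarrow> h i a b = G s \<zeta> \<nu> u i a b" for h s \<zeta> \<nu> u
    unfolding H_def using that by blast
  have G_add: "\<exists>\<nu>. design I \<nu> \<and> (\<forall>i<p. \<forall>a<k i. \<forall>b<k i.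
      G s1 \<zeta>1 \<nu>1 u1 i a b + G s2 \<zeta>2 \<nu>2 u2 i a b = G (s1 + s2) (\<zeta>1 + \<zeta>2) \<nu> (u1 + u2) i a b)"
    if nn: "0 \<le> s1" "0 \<le> s2" "design I \<nu>1" "design I \<nu>2" "u1 \<in> carrier_vec l" "u2 \<in> carrier_vec l"
    for s1 s2 \<zeta>1 \<zeta>2 \<nu>1 \<nu>2 u1 u2
  proof -
    obtain \<nu> where \<nu>: "design I \<nu>" and mix: "s1 \<cdot>\<^sub>m ?F \<nu>1 + s2 \<cdot>\<^sub>m ?F \<nu>2 = (s1 + s2) \<cdot>\<^sub>m ?F \<nu>"
      using fisher_mixture[OF nn(3,4,1,2)] by blast
    have "G s1 \<zeta>1 \<nu>1 u1 i a b + G s2 \<zeta>2 \<nu>2 u2 i a b = G (s1 + s2) (\<zeta>1 + \<zeta>2) \<nu> (u1 + u2) i a b"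
      if iab: "i < p" "a < k i" "b < k i" for i a b
    proof -
      have "s1 \<cdot>\<^sub>m A i (?F \<nu>1) + s2 \<cdot>\<^sub>m A i (?F \<nu>2) = (s1 + s2) \<cdot>\<^sub>m A i (?F \<nu>)"
        using A[OF iab(1)] arg_cong[OF mix, of "A i"] fisher_sym[of m f \<omega>] sym_mats_smult[OF fisher_sym[of m f \<omega>]]
        by (simp add: linear_sym_def)
      from arg_cong[OF this, of "\<lambda>X. X $$ (a, b)"]
      have "s1 * A i (?F \<nu>1) $$ (a, b) + s2 * A i (?F \<nu>2) $$ (a, b) = (s1 + s2) * A i (?F \<nu>) $$ (a, b)"
        using iab by (simp add: sym_mats_dim[OF AX[OF iab(1) fisher_sym]])
      moreover have "C i (u1 + u2) $$ (a, b) = C i u1 $$ (a, b) + C i u2 $$ (a, b)"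
        using C[OF iab(1)] nn(5,6) iab
        by (simp add: linear_vec_sym_def sym_mats_dim[OF Cu[OF iab(1)]])
      ultimately show ?thesis by (simp add: G_def algebra_simps)
    qed
    with \<nu> show ?thesis by blast
  qed
  have C_smult: "C i (c \<cdot>\<^sub>v u) $$ (a, b) = c * C i u $$ (a, b)"
    if "i < p" "a < k i" "b < k i" "u \<in> carrier_vec l" for i a b c u
    using C[OF that(1)] that by (simp add: linear_vec_sym_def sym_mats_dim[OF Cu[OF that(1,4)]])
  have none: "\<exists>i<p. \<exists>g. (\<Sum>a<k i. \<Sum>b<k i. h i a b * g a * g b) < (\<Sum>a<k i. g a * g a)"
    if h: "h \<in> H" for h
  proof (rule ccontr)
    assume "\<not> ?thesis"
    then have large: "(\<Sum>a<k i. g a * g a) \<le> (\<Sum>a<k i. \<Sum>b<k i. h i a b * g a * g b)" if "i < p" for i g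
      using that by (meson not_less)
    obtain s \<zeta> \<nu>0 u where s: "0 \<le> s" and \<zeta>: "0 \<le> \<zeta>" and \<nu>0: "design I \<nu>0" and u: "u \<in> carrier_vec l"
      and hG: "\<And>i a b. i < p \<Longrightarrow> a < k i \<Longrightarrow> b < k i \<Longrightarrow> h i a b = G s \<zeta> \<nu>0 u i a b"
      using h unfolding H_def by blast
    \<comment> \<open>Adding the inequality at the optimum makes \<open>s\<close> positive, and then there is room to raise the level.\<close>
    obtain \<nu> where \<nu>: "design I \<nu>" and sum: "\<And>i a b. i < p \<Longrightarrow> a < k i \<Longrightarrow> b < k i \<Longrightarrow>
        G s \<zeta> \<nu>0 u i a b + G 1 0 \<xi> u\<xi> i a b = G (s + 1) (\<zeta> + 0) \<nu> (u + u\<xi>) i a b"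
      using G_add[OF s zero_le_one \<nu>0 \<xi> u u\<xi>, of \<zeta> 0] by blast
    \<comment> \<open>Chosen so that - B is at most \<open>r\<close> times the identity in every
      block; the identity contained in \<open>h\<close> then pays for adding B / r. The summand 1
      keeps \<open>r\<close> positive.\<close>
    define r where "r = 1 + (\<Sum>i<p. \<Sum>a<k i. \<Sum>b<k i. \<bar>- B i $$ (a, b)\<bar>)"
    have r: "0 < r" unfolding r_def by (intro add_pos_nonneg sum_nonneg) auto
    define v where "v = (1 / (s + 1)) \<cdot>\<^sub>v (u + u\<xi>)"
    have v: "v \<in> carrier_vec l" using u u\<xi> by (simp add: v_def)
    \<comment> \<open>Dividing the homogeneous inequality by s + 1 turns its level into z + zeta /
      (s + 1) and the additional B / r into a rise by 1 / (r * (s + 1)), which is strictly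
      positive.\<close>
    define z' where "z' = z + \<zeta> / (s + 1) + 1 / (r * (s + 1))"
    have "lmi (A i) (B i) (C i) (D i) (?F \<nu>) z' v \<in> psd_mats (k i)" if i: "i < p" for i
      unfolding psd_mats_iff
    proof (intro conjI allI lmi_sym i v fisher_sym)
      fix g :: "nat \<Rightarrow> real"
      let ?q = "\<lambda>M. \<Sum>a<k i. \<Sum>b<k i. M a b * g a * g b"
      define N where "N = (\<Sum>a<k i. g a * g a)"
      have N0: "0 \<le> N" by (simp add: N_def sum_nonneg)
      have entry: "lmi (A i) (B i) (C i) (D i) (?F \<nu>) z' v $$ (a, b) =
          (h i a b + lmi (A i) (B i) (C i) (D i) (?F \<xi>) z u\<xi> $$ (a, b) + (1 / r) * B i $$ (a, b)) / (s + 1)"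
        if ab: "a < k i" "b < k i" for a b
      proof -
        define S where "S = s + 1"
        have S: "0 < S" using s by (simp add: S_def)
        have scalar: "\<alpha> + (z + \<zeta> / S + 1 / (r * S)) * \<beta> + 1 / S * \<gamma> + \<delta> =
            (S * \<alpha> + (S * z + \<zeta>) * \<beta> + \<gamma> + S * \<delta> + (1 / r) * \<beta>) / S" for \<alpha> \<beta> \<gamma> \<delta> :: real
          using S by (simp add: add_divide_distrib distrib_right mult.assoc)
        have "h i a b + lmi (A i) (B i) (C i) (D i) (?F \<xi>) z u\<xi> $$ (a, b) = G S \<zeta> \<nu> (u + u\<xi>) i a b"
          using sum[OF i ab] by (simp add: lmi_index[OF i fisher_sym u\<xi> ab] hG[OF i ab] G_def S_def)
        then show ?thesis
          unfolding lmi_index[OF i fisher_sym v ab]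
          unfolding v_def z'_def C_smult[OF i ab add_carrier_vec[OF u u\<xi>]]
            S_def[symmetric] scalar by (simp only: G_def)
      qed
      have "?q (\<lambda>a b. lmi (A i) (B i) (C i) (D i) (?F \<nu>) z' v $$ (a, b)) =
          ?q (\<lambda>a b. (h i a b + lmi (A i) (B i) (C i) (D i) (?F \<xi>) z u\<xi> $$ (a, b) + (1 / r) * B i $$ (a, b)) / (s + 1))"
        by (intro sum.cong refl) (simp add: entry)
      also have "\<dots> = (?q (h i) + ?q (\<lambda>a b. lmi (A i) (B i) (C i) (D i) (?F \<xi>) z u\<xi> $$ (a, b))
          + (1 / r) * ?q (\<lambda>a b. B i $$ (a, b))) / (s + 1)"
        by (simp only: sum_divide_distrib sum_distrib_left sum.distrib[symmetric])
          (intro sum.cong refl, simp add: field_simps)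
      also have "0 \<le> \<dots>"
      proof (intro divide_nonneg_nonneg)
        have "- ?q (\<lambda>a b. B i $$ (a, b)) \<le> (\<Sum>a<k i. \<Sum>b<k i. \<bar>- B i $$ (a, b)\<bar>) * N"
          using quadratic_form_bound[of "\<lambda>a b. - B i $$ (a, b)" g "k i"] by (simp add: sum_negf N_def)
        also have "\<dots> \<le> r * N"
        proof (intro mult_right_mono N0)
          have "(\<Sum>a<k i. \<Sum>b<k i. \<bar>- B i $$ (a, b)\<bar>) \<le> (\<Sum>i<p. \<Sum>a<k i. \<Sum>b<k i. \<bar>- B i $$ (a, b)\<bar>)"
            using i by (intro member_le_sum[of i _ "\<lambda>i. \<Sum>a<k i. \<Sum>b<k i. \<bar>- B i $$ (a, b)\<bar>"])
              (auto intro!: sum_nonneg)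
          then show "(\<Sum>a<k i. \<Sum>b<k i. \<bar>- B i $$ (a, b)\<bar>) \<le> r" by (simp add: r_def)
        qed
        finally have "- N \<le> (1 / r) * ?q (\<lambda>a b. B i $$ (a, b))"
          using r by (simp add: field_simps)
        moreover have "N \<le> ?q (h i)" unfolding N_def by (rule large[OF i])
        moreover have "0 \<le> ?q (\<lambda>a b. lmi (A i) (B i) (C i) (D i) (?F \<xi>) z u\<xi> $$ (a, b))"
          using lmi\<xi>[OF i] by (simp add: psd_mats_iff)
        ultimately show "0 \<le> ?q (h i) + ?q (\<lambda>a b. lmi (A i) (B i) (C i) (D i) (?F \<xi>) z u\<xi> $$ (a, b))
          + (1 / r) * ?q (\<lambda>a b. B i $$ (a, b))" by linarith
      qed (use s in auto)
      finally show "0 \<le> ?q (\<lambda>a b. lmi (A i) (B i) (C i) (D i) (?F \<nu>) z' v $$ (a, b))" .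
    qed
    then have "z' \<le> \<Phi> (?F \<nu>)" using lmi_iff[OF \<nu>, of z'] v by blast
    then have "z' \<le> z" using max[OF \<nu>] by simp
    moreover have "0 \<le> \<zeta> / (s + 1)" "0 < 1 / (r * (s + 1))" using s \<zeta> r by auto
    ultimately show False unfolding z'_def by linarith
  qed
  have "\<exists>w. (\<forall>h\<in>H. (\<Sum>i<p. \<Sum>a<k i. \<Sum>b<k i. w i a b * h i a b) \<le> 0) \<and>
      (\<forall>i<p. \<forall>g. 0 \<le> (\<Sum>a<k i. \<Sum>b<k i. w i a b * g a * g b)) \<and> 1 \<le> (\<Sum>i<p. \<Sum>a<k i. w i a a)"
  proof (rule psd_alternative)
    \<comment> \<open>The zero vector is written as a multiple so that \<open>C_smult\<close> makes
      its image vanish.\<close>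
    have "G 0 0 \<xi> (0 \<cdot>\<^sub>v 0\<^sub>v l) i a b = 0" if "i < p" "a < k i" "b < k i" for i a b
      using C_smult[OF that, of "0\<^sub>v l" 0] by (simp add: G_def)
    then show "(\<lambda>i a b. 0) \<in> H"
      by (intro HI[OF order_refl order_refl \<xi>, of "0 \<cdot>\<^sub>v 0\<^sub>v l"]) auto
  next
    fix h h' assume "h \<in> H" and h': "h' \<in> H"
    then obtain s \<zeta> \<nu> u where nn1: "0 \<le> s" "0 \<le> \<zeta>" "design I \<nu>" "u \<in> carrier_vec l"
      and hG1: "\<forall>i<p. \<forall>a<k i. \<forall>b<k i. h i a b = G s \<zeta> \<nu> u i a b"
      unfolding H_def by blast
    obtain s' \<zeta>' \<nu>' u' where nn2: "0 \<le> s'" "0 \<le> \<zeta>'" "design I \<nu>'" "u' \<in> carrier_vec l"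
      and hG2: "\<forall>i<p. \<forall>a<k i. \<forall>b<k i. h' i a b = G s' \<zeta>' \<nu>' u' i a b"
      using h' unfolding H_def by blast
    obtain \<mu> where "design I \<mu>" "\<forall>i<p. \<forall>a<k i. \<forall>b<k i.
        G s \<zeta> \<nu> u i a b + G s' \<zeta>' \<nu>' u' i a b = G (s + s') (\<zeta> + \<zeta>') \<mu> (u + u') i a b"
      using G_add[OF nn1(1) nn2(1) nn1(3) nn2(3) nn1(4) nn2(4), of \<zeta> \<zeta>'] by blast
    then show "(\<lambda>i a b. h i a b + h' i a b) \<in> H"
      using nn1 nn2 hG1 hG2 by (intro HI[of "s + s'" "\<zeta> + \<zeta>'" \<mu> "u + u'"]) simp_all
  next
    fix c :: real and h assume c: "0 < c" and "h \<in> H"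
    then obtain s \<zeta> \<nu> u where nn: "0 \<le> s" "0 \<le> \<zeta>" "design I \<nu>" "u \<in> carrier_vec l"
      and hG: "\<forall>i<p. \<forall>a<k i. \<forall>b<k i. h i a b = G s \<zeta> \<nu> u i a b"
      unfolding H_def by blast
    have "c * G s \<zeta> \<nu> u i a b = G (c * s) (c * \<zeta>) \<nu> (c \<cdot>\<^sub>v u) i a b" if "i < p" "a < k i" "b < k i" for i a b
      unfolding G_def C_smult[OF that nn(4)] by (simp add: algebra_simps)
    then show "(\<lambda>i a b. c * h i a b) \<in> H"
      using nn hG c by (intro HI[of "c * s" "c * \<zeta>" \<nu> "c \<cdot>\<^sub>v u"]) simp_all
  qed (rule none)
  then obtain w where wH: "\<And>h. h \<in> H \<Longrightarrow> (\<Sum>i<p. \<Sum>a<k i. \<Sum>b<k i. w i a b * h i a b) \<le> 0"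
    and w_psd: "\<And>i g. i < p \<Longrightarrow> 0 \<le> (\<Sum>a<k i. \<Sum>b<k i. w i a b * g a * g b)"
    and w_trace: "1 \<le> (\<Sum>i<p. \<Sum>a<k i. w i a a)" by blast
  \<comment> \<open>\<open>psd_alternative\<close> asserts no symmetry of \<open>w\<close>. Its
    symmetric part has the same diagonal and the same pairing with symmetric matrices.\<close>
  define V where "V i = mat (k i) (k i) (\<lambda>(a, b). (w i a b + w i b a) / 2)" for i
  have V_car: "V i \<in> carrier_mat (k i) (k i)" for i by (simp add: V_def)
  have V_sum: "(\<Sum>a<k i. \<Sum>b<k i. V i $$ (a, b) * X a b) = (\<Sum>a<k i. \<Sum>b<k i. w i a b * X a b)"
    if "\<And>a b. a < k i \<Longrightarrow> b < k i \<Longrightarrow> X a b = X b a" for i and X :: "nat \<Rightarrow> nat \<Rightarrow> real"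
  proof -
    have "(\<Sum>a<k i. \<Sum>b<k i. w i b a * X a b) = (\<Sum>b<k i. \<Sum>a<k i. w i b a * X a b)"
      by (rule sum.swap)
    also have "\<dots> = (\<Sum>b<k i. \<Sum>a<k i. w i b a * X b a)"
      using that by (intro sum.cong refl) auto
    finally have swap: "(\<Sum>a<k i. \<Sum>b<k i. w i b a * X a b) = (\<Sum>a<k i. \<Sum>b<k i. w i a b * X a b)" .
    have "(\<Sum>a<k i. \<Sum>b<k i. V i $$ (a, b) * X a b) =
        (\<Sum>a<k i. \<Sum>b<k i. (w i a b * X a b + w i b a * X a b) / 2)"
      by (intro sum.cong refl) (simp add: V_def algebra_simps add_divide_distrib)
    also have "\<dots> = ((\<Sum>a<k i. \<Sum>b<k i. w i a b * X a b) + (\<Sum>a<k i. \<Sum>b<k i. w i b a * X a b)) / 2"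
      by (simp only: sum_divide_distrib[symmetric] sum.distrib)
    finally show ?thesis by (simp add: swap)
  qed
  have V_psd: "V i \<in> psd_mats (k i)" if "i < p" for i
    unfolding psd_mats_iff
  proof (intro conjI allI)
    show "V i \<in> sym_mats (k i)" by (rule sym_matsI) (auto simp: V_def add.commute)
    show "0 \<le> (\<Sum>a<k i. \<Sum>b<k i. V i $$ (a, b) * g a * g b)" for g
      using V_sum[of i "\<lambda>a b. g a * g b"] w_psd[OF that, of g] by (simp add: mult_ac)
  qed
  have V_frob: "frob (V i) X = (\<Sum>a<k i. \<Sum>b<k i. w i a b * X $$ (a, b))" if "X \<in> sym_mats (k i)" for i X
    unfolding frob_carrier[OF V_car] using sym_mats_sym[OF that] by (intro V_sum)
  define \<phi> where "\<phi> X = (\<Sum>i<p. frob (V i) (A i X))" for X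
  define \<beta> where "\<beta> = (\<Sum>i<p. frob (V i) (B i))"
  define \<gamma> where "\<gamma> u = (\<Sum>i<p. frob (V i) (C i u))" for u
  define \<delta> where "\<delta> = (\<Sum>i<p. frob (V i) (D i))"
  have \<phi>: "sym_functional m \<phi>"
    unfolding \<phi>_def[abs_def] by (intro sym_functional_sum sym_functional_frob[OF A V_car]) simp
  have ineq: "s * \<phi> (?F \<nu>) + (s * z + \<zeta>) * \<beta> + \<gamma> u + s * \<delta> \<le> 0"
    if "0 \<le> s" "0 \<le> \<zeta>" "design I \<nu>" "u \<in> carrier_vec l" for s \<zeta> \<nu> u
  proof -
    have "G s \<zeta> \<nu> u \<in> H" using that by (rule HI) simp
    then have "(\<Sum>i<p. \<Sum>a<k i. \<Sum>b<k i. w i a b * G s \<zeta> \<nu> u i a b) \<le> 0" by (rule wH)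
    also have "(\<Sum>i<p. \<Sum>a<k i. \<Sum>b<k i. w i a b * G s \<zeta> \<nu> u i a b) =
        (\<Sum>i<p. s * frob (V i) (A i (?F \<nu>)) + (s * z + \<zeta>) * frob (V i) (B i) + frob (V i) (C i u) + s * frob (V i) (D i))"
    proof (intro sum.cong[OF refl])
      fix i assume "i \<in> {..<p}"
      then have i: "i < p" by simp
      show "(\<Sum>a<k i. \<Sum>b<k i. w i a b * G s \<zeta> \<nu> u i a b) =
          s * frob (V i) (A i (?F \<nu>)) + (s * z + \<zeta>) * frob (V i) (B i) + frob (V i) (C i u) + s * frob (V i) (D i)"
        unfolding V_frob[OF AX[OF i fisher_sym]] V_frob[OF B[OF i]] V_frob[OF Cu[OF i that(4)]] V_frob[OF D[OF i]]
          sum_distrib_left sum.distrib[symmetric]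
        by (intro sum.cong refl) (simp add: G_def algebra_simps)
    qed
    finally show ?thesis
      by (simp add: \<phi>_def \<beta>_def \<gamma>_def \<delta>_def sum.distrib sum_distrib_left)
  qed
  \<comment> \<open>At s = zeta = 0 only the term in \<open>u\<close> is left, and applying this to
    \<open>u\<close> and to its negative forces equality.\<close>
  have \<gamma>_le: "\<gamma> u \<le> 0" if "u \<in> carrier_vec l" for u
    using ineq[OF order_refl order_refl \<xi> that] by simp
  have frob_Cu: "frob (V i) (C i (c \<cdot>\<^sub>v u)) = c * frob (V i) (C i u)" if "i < p" "u \<in> carrier_vec l" for i c u
    using C[OF that(1)] that(2) frob_smult[OF V_car sym_mats_carrier[OF Cu[OF that]]]
    by (simp add: linear_vec_sym_def)
  have \<gamma>_smult: "\<gamma> (c \<cdot>\<^sub>v u) = c * \<gamma> u" if "u \<in> carrier_vec l" for c u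
    using that by (simp add: \<gamma>_def frob_Cu sum_distrib_left)
  have \<gamma>: "\<gamma> u = 0" if "u \<in> carrier_vec l" for u
    using \<gamma>_le[OF that] \<gamma>_le[of "(-1) \<cdot>\<^sub>v u"] \<gamma>_smult[OF that, of "-1"] that by simp
  \<comment> \<open>s = 0 and zeta = 1 isolate the direction that raises the level alone.\<close>
  have \<beta>_le: "\<beta> \<le> 0"
    using ineq[OF order_refl zero_le_one \<xi> zero_carrier_vec] \<gamma>[OF zero_carrier_vec] by simp
  have point: "\<phi> (fisher_point m f \<omega> t) + z * \<beta> + \<delta> \<le> 0" if "t \<in> I" for t
    using ineq[OF zero_le_one order_refl design_return[OF that] zero_carrier_vec] \<gamma>[OF zero_carrier_vec]
    by (simp add: fisher_return_pmf)
  have frob_lmi: "(\<Sum>i<p. frob (V i) (lmi (A i) (B i) (C i) (D i) X s u)) = \<phi> X + s * \<beta> + \<gamma> u + \<delta>"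
    if "X \<in> sym_mats m" "u \<in> carrier_vec l" for X s u
  proof -
    have "frob (V i) (lmi (A i) (B i) (C i) (D i) X s u) =
        frob (V i) (A i X) + s * frob (V i) (B i) + frob (V i) (C i u) + frob (V i) (D i)" if i: "i < p" for i
      using sym_mats_carrier[OF AX[OF i \<open>X \<in> sym_mats m\<close>]] sym_mats_carrier[OF B[OF i]]
        sym_mats_carrier[OF Cu[OF i \<open>u \<in> carrier_vec l\<close>]] sym_mats_carrier[OF D[OF i]]
      unfolding lmi_def by (simp add: frob_add[OF V_car] frob_smult[OF V_car])
    then show ?thesis by (simp add: \<phi>_def \<beta>_def \<gamma>_def \<delta>_def sum.distrib sum_distrib_left)
  qed
  \<comment> \<open>For vanishing beta the level of the strictly feasible point drops out, so
    \<open>V\<close> pairs with its positive definite blocks to at most 0. Then every block of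
    \<open>V\<close> is zero, against the trace of \<open>w\<close> being at least 1.\<close>
  have "\<beta> \<noteq> 0"
  proof
    assume \<beta>0: "\<beta> = 0"
    obtain X s u where X: "X \<in> mat_convex_hull m (fisher_point m f \<omega> ` I)" and u: "u \<in> carrier_vec l"
      and pd: "\<And>i. i < p \<Longrightarrow> lmi (A i) (B i) (C i) (D i) X s u \<in> pd_mats (k i)"
      using adm unfolding witnesses_admissibility_def by blast
    have sub: "fisher_point m f \<omega> ` I \<subseteq> sym_mats m" using fisher_point_sym by blast
    have "\<phi> X \<le> - \<delta>"
      using point \<beta>0 by (intro sym_functional_hull_le[OF \<phi> X sub]) fastforce
    then have le: "(\<Sum>i<p. frob (V i) (lmi (A i) (B i) (C i) (D i) X s u)) \<le> 0"
      using frob_lmi[OF mat_convex_hull_sym[OF X sub] u] \<beta>0 \<gamma>[OF u] by simp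
    have nn: "0 \<le> frob (V i) (lmi (A i) (B i) (C i) (D i) X s u)" if "i < p" for i
      using that by (intro frob_psd_nonneg[OF V_psd pd_mats_psd[OF pd]])
    have zero: "(\<Sum>i<p. frob (V i) (lmi (A i) (B i) (C i) (D i) X s u)) = 0"
      using le nn by (intro order_antisym sum_nonneg) auto
    have "frob (V i) (lmi (A i) (B i) (C i) (D i) X s u) = 0" if "i < p" for i
      using nn that by (intro sum_nonneg_0[OF finite_lessThan _ zero]) auto
    then have "V i $$ (a, a) = 0" if "i < p" "a < k i" for i a
      using frob_pd_zero[OF V_psd pd] that by blast
    then have "w i a a = 0" if "i < p" "a < k i" for i a
      using that by (fastforce simp: V_def)
    then show False using w_trace by simp
  qed
  with \<beta>_le have \<beta>: "\<beta> < 0" by simp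
  define c where "c = - 1 / \<beta>"
  have c: "0 < c" "c * \<beta> = -1" using \<beta> by (auto simp: c_def)
  define W where "W i = c \<cdot>\<^sub>m V i" for i
  have W_frob: "frob (W i) X = c * frob (V i) X" for i X
    unfolding W_def by (rule frob_smult_left[OF V_car])
  show ?thesis
  proof (intro exI[of _ W] conjI allI impI ballI)
    show "W i \<in> psd_mats (k i)" if "i < p" for i
      unfolding psd_mats_iff
    proof (intro conjI allI)
      show "W i \<in> sym_mats (k i)"
        unfolding W_def using V_psd[OF that] by (intro sym_mats_smult) (simp add: psd_mats_iff)
      fix g
      have "(\<Sum>a<k i. \<Sum>b<k i. W i $$ (a, b) * g a * g b) = c * (\<Sum>a<k i. \<Sum>b<k i. V i $$ (a, b) * g a * g b)"
        using V_car[of i] by (simp add: W_def sum_distrib_left mult.assoc)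
      then show "0 \<le> (\<Sum>a<k i. \<Sum>b<k i. W i $$ (a, b) * g a * g b)"
        using V_psd[OF that] c by (simp add: psd_mats_iff)
    qed
    show "(\<Sum>i<p. frob (W i) (B i)) = -1"
      using c(2) by (simp add: W_frob \<beta>_def sum_distrib_left)
    show "(\<Sum>i<p. frob (W i) (C i u)) = 0" if "u \<in> carrier_vec l" for u
      using \<gamma>[OF that] by (simp add: W_frob \<gamma>_def flip: sum_distrib_left)
    fix t assume t: "t \<in> I"
    have "(\<Sum>i<p. frob (W i) (A i (fisher_point m f \<omega> t) + D i)) = c * (\<phi> (fisher_point m f \<omega> t) + \<delta>)"
    proof -
      have "frob (V i) (A i (fisher_point m f \<omega> t) + D i) =
          frob (V i) (A i (fisher_point m f \<omega> t)) + frob (V i) (D i)" if "i < p" for i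
        using AX[OF that fisher_point_sym] D[OF that] by (intro frob_add[OF V_car] sym_mats_carrier)
      then show ?thesis by (simp add: W_frob \<phi>_def \<delta>_def sum.distrib flip: sum_distrib_left)
    qed
    also have "\<dots> \<le> c * (- (z * \<beta>))" using point[OF t] c(1) by (intro mult_left_mono) auto
    also have "\<dots> = - (c * \<beta>) * z" by simp
    also have "\<dots> = z" using c(2) by simp
    finally show "(\<Sum>i<p. frob (W i) (A i (fisher_point m f \<omega> t) + D i)) \<le> \<Phi> (fisher m f \<omega> \<xi>)"
      by (simp add: z_def)
  qed
qed

section \<open>Weak duality and complementary slackness\<close>

theorem theorem9:
  fixes m p l :: nat
    and I :: "real set"
    and f :: "nat \<Rightarrow> real poly fract"
    and \<omega> :: "real poly fract"
    and \<Phi> :: "real mat \<Rightarrow> real"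
    and k :: "nat \<Rightarrow> nat"
    and A :: "nat \<Rightarrow> real mat \<Rightarrow> real mat"
    and B D :: "nat \<Rightarrow> real mat"
    and C :: "nat \<Rightarrow> real vec \<Rightarrow> real mat"
    and L \<pi> :: "real poly"
    and \<xi> :: "real pmf"
    and y :: real
    and W :: "nat \<Rightarrow> real mat"
  assumes m_pos: "1 \<le> m"
    and region: "finite_interval_union I"
    and f_indep: "rat_lin_indep m f"
    and f_finite: "\<And>i t. i < m \<Longrightarrow> t \<in> I \<Longrightarrow> poly (den (f i)) t \<noteq> 0"
    and den_pos: "\<exists>c. \<forall>t\<in>I. 0 < c * poly (den \<omega>) t"
    and nonneg: "\<And>t. t \<in> I \<Longrightarrow> 0 \<le> rat_eval \<omega> t"
    and admissible: "witnesses_admissibility m (mat_convex_hull m (fisher_point m f \<omega> ` I)) \<Phi> p k l A B C D"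
    and lcm: "normalize L = den_lcm m f \<omega>" and lcm_pos: "\<And>t. t \<in> I \<Longrightarrow> 0 < poly L t"
    and clears: "\<And>y W. (\<And>i. i < p \<Longrightarrow> W i \<in> psd_mats (k i)) \<Longrightarrow> \<exists>q. is_dual_poly m f \<omega> L p A D y W q"
    and optimal: "optimal_design m f \<omega> I \<Phi> \<xi>"
    and solution: "sdp_solution m f \<omega> I L p k l A B C D (y, \<pi>, W)"
  shows "set_pmf \<xi> \<subseteq> {t. poly \<pi> t = 0}"
proof -
  let ?z = "\<Phi> (fisher m f \<omega> \<xi>)"
  have rep: "sd_representation m \<Phi> p k l A B C D"
    using admissible by (simp add: witnesses_admissibility_def)
  have A: "linear_sym m (k i) (A i)" and B: "B i \<in> sym_mats (k i)"
    and C: "linear_vec_sym l (k i) (C i)" and D: "D i \<in> sym_mats (k i)" if "i < p" for i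
    using rep that by (auto simp: sd_representation_def)
  have \<xi>: "design I \<xi>" using optimal by (simp add: optimal_design_def is_arg_max_def)
  \<comment> \<open>The support of a design is nonempty, so the region is nonempty and positivity of
    \<open>L\<close> on it excludes L = 0.\<close>
  then obtain t0 where "t0 \<in> I" using set_pmf_not_empty[of \<xi>] by (auto simp: design_def)
  then have L: "L \<noteq> 0" using lcm_pos by force
  have eval: "poly (dual_poly m f \<omega> L p A D y W) t =
      poly L t * (y - (\<Sum>i<p. frob (W i) (A i (fisher_point m f \<omega> t) + D i)))"
    if "\<And>i. i < p \<Longrightarrow> W i \<in> psd_mats (k i)" "t \<in> I" for y W t
    using is_dual_poly_dual_poly[OF L clears[of W y, OF that(1)]] lcm_pos[OF that(2)]
    by (auto simp: is_dual_poly_def)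
  obtain W' where W': "\<And>i. i < p \<Longrightarrow> W' i \<in> psd_mats (k i)" "(\<Sum>i<p. frob (W' i) (B i)) = -1"
    and W'C: "\<And>u. u \<in> carrier_vec l \<Longrightarrow> (\<Sum>i<p. frob (W' i) (C i u)) = 0"
    and W'A: "\<And>t. t \<in> I \<Longrightarrow> (\<Sum>i<p. frob (W' i) (A i (fisher_point m f \<omega> t) + D i)) \<le> ?z"
    using strong_duality[OF admissible nonneg optimal] by blast
  \<comment> \<open>The multiplier of strong duality is feasible with objective value
    \<open>?z\<close>, so minimality bounds \<open>y\<close> by the optimal value.\<close>
  have "sdp_feasible m f \<omega> I L p k l A B C D (?z, dual_poly m f \<omega> L p A D ?z W', W')"
  proof -
    have "(\<Sum>i<p. adjoint_vec l (C i) (W' i) $ j) = 0" if "j < l" for j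
    proof -
      have "adjoint_vec l (C i) (W' i) $ j = frob (W' i) (C i (unit_vec l j))" if "i < p" for i
        using adjoint_vec_index[OF C[OF that] sym_mats_carrier \<open>j < l\<close>] W'(1)[OF that] by (simp add: psd_mats_iff)
      then show ?thesis using W'C[of "unit_vec l j"] by simp
    qed
    moreover have "0 \<le> poly (dual_poly m f \<omega> L p A D ?z W') t" if "t \<in> I" for t
    proof -
      have "poly (dual_poly m f \<omega> L p A D ?z W') t =
          poly L t * (?z - (\<Sum>i<p. frob (W' i) (A i (fisher_point m f \<omega> t) + D i)))"
        using W'(1) that by (rule eval)
      then show ?thesis using lcm_pos[OF that] W'A[OF that] by simp
    qed
    moreover have "degree (dual_poly m f \<omega> L p A D ?z W') \<le> dual_degree m f \<omega> L p k A D"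
      by (rule degree_dual_poly_le_dual_degree[OF L A D clears W'(1)])
    ultimately show ?thesis using W' by (simp add: sdp_feasible_def nonneg_polys_def)
  qed
  then have y: "y \<le> ?z"
    using solution unfolding sdp_solution_def is_arg_min_def by force
  have "sdp_feasible m f \<omega> I L p k l A B C D (y, \<pi>, W)"
    using solution by (simp add: sdp_solution_def is_arg_min_def)
  then have W: "\<And>i. i < p \<Longrightarrow> W i \<in> psd_mats (k i)" and WB: "(\<Sum>i<p. frob (W i) (B i)) = -1"
    and WC: "\<And>j. j < l \<Longrightarrow> (\<Sum>i<p. adjoint_vec l (C i) (W i) $ j) = 0"
    and \<pi>: "\<pi> = dual_poly m f \<omega> L p A D y W" and \<pi>_nn: "\<And>t. t \<in> I \<Longrightarrow> 0 \<le> poly \<pi> t"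
    by (auto simp: sdp_feasible_def nonneg_polys_def)
  have Wc: "W i \<in> carrier_mat (k i) (k i)" if "i < p" for i
    using W[OF that] by (simp add: psd_mats_iff sym_mats_carrier)
  define \<phi> where "\<phi> X = (\<Sum>i<p. frob (W i) (A i X))" for X
  define \<delta> where "\<delta> = (\<Sum>i<p. frob (W i) (D i))"
  have \<phi>: "sym_functional m \<phi>"
    unfolding \<phi>_def[abs_def] by (intro sym_functional_sum sym_functional_frob[OF A Wc]) auto
  have AX: "A i X \<in> carrier_mat (k i) (k i)" if "i < p" "X \<in> sym_mats m" for i X
    using A[OF that(1)] that(2) by (simp add: linear_sym_def sym_mats_carrier)
  have Dc: "D i \<in> carrier_mat (k i) (k i)" and Bc: "B i \<in> carrier_mat (k i) (k i)" if "i < p" for i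
    using B[OF that] D[OF that] by (simp_all add: sym_mats_carrier)
  have split: "(\<Sum>i<p. frob (W i) (A i X + D i)) = \<phi> X + \<delta>" if "X \<in> sym_mats m" for X
    using that by (simp add: \<phi>_def \<delta>_def frob_add[OF Wc AX Dc] sum.distrib)
  \<comment> \<open>On the region this is the quotient of the polynomial by \<open>L\<close>: the
    slack of the dual constraint at t.\<close>
  define gap where "gap t = y - (\<phi> (fisher_point m f \<omega> t) + \<delta>)" for t
  have \<pi>_eval: "poly \<pi> t = poly L t * gap t" if "t \<in> I" for t
  proof -
    have "poly \<pi> t = poly L t * (y - (\<Sum>i<p. frob (W i) (A i (fisher_point m f \<omega> t) + D i)))"
      unfolding \<pi> using W that by (rule eval)
    then show ?thesis by (simp only: split[OF fisher_point_sym] gap_def)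
  qed
  have gap_nn: "0 \<le> gap t" if "t \<in> I" for t
    using \<pi>_nn[OF that] lcm_pos[OF that] \<pi>_eval[OF that] by (simp add: zero_le_mult_iff)
  have sub: "set_pmf \<xi> \<subseteq> I" and fin: "finite (set_pmf \<xi>)" using \<xi> by (auto simp: design_def)
  \<comment> \<open>The inequality is taken at the level \<open>?z\<close> of the design itself.
    Paired with \<open>W\<close>, the term of \<open>B\<close> contributes - ?z and the term of
    \<open>C\<close> nothing.\<close>
  have weak: "?z \<le> \<phi> (fisher m f \<omega> \<xi>) + \<delta>"
  proof -
    obtain u where u: "u \<in> carrier_vec l"
      and lmi: "\<And>i. i < p \<Longrightarrow> lmi (A i) (B i) (C i) (D i) (fisher m f \<omega> \<xi>) ?z u \<in> psd_mats (k i)"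
      using rep fisher_psd[OF \<xi> nonneg] unfolding sd_representation_def by blast
    have Cc: "C i u \<in> carrier_mat (k i) (k i)" if "i < p" for i
      using C[OF that] u by (simp add: linear_vec_sym_def sym_mats_carrier)
    have "(\<Sum>i<p. frob (W i) (C i u)) = (\<Sum>i<p. \<Sum>j<l. u $ j * adjoint_vec l (C i) (W i) $ j)"
      using frob_adjoint_vec[OF C Wc u] by simp
    also have "\<dots> = (\<Sum>j<l. \<Sum>i<p. u $ j * adjoint_vec l (C i) (W i) $ j)" by (rule sum.swap)
    also have "\<dots> = 0" by (simp add: WC flip: sum_distrib_left)
    finally have C0: "(\<Sum>i<p. frob (W i) (C i u)) = 0" .
    have "0 \<le> (\<Sum>i<p. frob (W i) (lmi (A i) (B i) (C i) (D i) (fisher m f \<omega> \<xi>) ?z u))"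
      by (intro sum_nonneg frob_psd_nonneg[OF W lmi]) auto
    also have "\<dots> = (\<Sum>i<p. frob (W i) (A i (fisher m f \<omega> \<xi>)) + ?z * frob (W i) (B i) + frob (W i) (C i u) + frob (W i) (D i))"
    proof (intro sum.cong[OF refl])
      fix i assume "i \<in> {..<p}"
      then have i: "i < p" by simp
      show "frob (W i) (lmi (A i) (B i) (C i) (D i) (fisher m f \<omega> \<xi>) ?z u) =
          frob (W i) (A i (fisher m f \<omega> \<xi>)) + ?z * frob (W i) (B i) + frob (W i) (C i u) + frob (W i) (D i)"
        using AX[OF i fisher_sym[of m f \<omega> \<xi>]] Bc[OF i] Cc[OF i] Dc[OF i]
        unfolding lmi_def by (simp add: frob_add[OF Wc[OF i]] frob_smult[OF Wc[OF i]])
    qed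
    finally show ?thesis
      using C0 WB by (simp add: \<phi>_def \<delta>_def sum.distrib flip: sum_distrib_left)
  qed
  \<comment> \<open>The slack is affine in the information matrix, so its mean over the design is
    its value at the Fisher matrix.\<close>
  have "(\<Sum>t\<in>set_pmf \<xi>. pmf \<xi> t * gap t) = y - (\<phi> (fisher m f \<omega> \<xi>) + \<delta>)"
  proof -
    have "(\<Sum>t\<in>set_pmf \<xi>. pmf \<xi> t * gap t) =
        (\<Sum>t\<in>set_pmf \<xi>. pmf \<xi> t) * (y - \<delta>) - (\<Sum>t\<in>set_pmf \<xi>. pmf \<xi> t * \<phi> (fisher_point m f \<omega> t))"
      unfolding sum_distrib_right sum_subtractf[symmetric] gap_def
      by (intro sum.cong refl) (simp add: algebra_simps)
    then show ?thesis by (simp add: sum_pmf_design[OF \<xi>] sym_functional_fisher[OF \<phi> \<xi>])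
  qed
  then have le: "(\<Sum>t\<in>set_pmf \<xi>. pmf \<xi> t * gap t) \<le> 0" using y weak by simp
  have nn: "0 \<le> pmf \<xi> t * gap t" if "t \<in> set_pmf \<xi>" for t
    using gap_nn sub that by (intro mult_nonneg_nonneg pmf_nonneg) auto
  have zero: "(\<Sum>t\<in>set_pmf \<xi>. pmf \<xi> t * gap t) = 0"
    using le nn by (intro order_antisym sum_nonneg)
  \<comment> \<open>Weights are nonzero on the support, so the slack itself vanishes there, and the
    polynomial with it.\<close>
  have "pmf \<xi> t * gap t = 0" if "t \<in> set_pmf \<xi>" for t
    using nn that by (intro sum_nonneg_0[OF fin _ zero])
  then show ?thesis
    using \<pi>_eval sub by (auto simp: set_pmf_iff)
qed

end
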